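(* There exist a tree metric $\mathcal{T}$ and a constant $c>0$ such that for all integers $h\le k$ with $h$ sufficiently large, $\mathcal{R}_{\mathcal{T}}(h,k)\ge c\cdot\log\log h$. In other words, $\mathcal{R}_{\mathcal{T}}(h,k)=\Omega(\log\log h)$, and this holds even for arbitrarily large $k$ (the bound does not depend on $k$).
   Context: The $k$-server problem on a metric space $(\mathcal{X},d)$: an algorithm controls $k$ servers located at points of $\mathcal{X}$; a sequence of requests $r_1,r_2,\dots$ (points of $\mathcal{X}$) arrives online, and upon request $r_i$ the algorithm must move its servers so that one of them is at $r_i$; the cost is the total distance travelled by all servers. In the $(h,k)$-server problem ($h\le k$), an online algorithm using $k$ servers is compared with an optimal offline algorithm using $h$ servers. An online algorithm $\mathrm{ALG}$ is $\rho$-competitive if there is a constant $C\ge 0$ such that for every request sequence $\sigma$, $\mathrm{ALG}(\sigma)\le \rho\cdot \mathrm{OPT}(\sigma)+C$, where $\mathrm{OPT}(\sigma)$ is the optimal offline cost of serving $\sigma$ with $h$ servers; for a randomized algorithm, $\mathrm{ALG}(\sigma)$ is replaced by its expected cost. $\mathcal{R}_{\mathcal{X}}(h,k)$ denotes the infimum of $\rho$ such that a $\rho$-competitive randomized online algorithm with $k$ servers exists for the $(h,k)$-server problem on $\mathcal{X}$ (against $h$ offline servers). The tree metric may be infinite; servers start at the root of the tree. *)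

theory Defs
  imports "HOL-Probability.Probability"
begin

section \<open>Tree metrics\<close>

text \<open>Undirected simple graphs, possibly infinite, are given by a vertex set \<open>V\<close> and a set \<open>E\<close> of
  two-element subsets of \<open>V\<close>.\<close>

definition walk :: "'a set set \<Rightarrow> 'a \<Rightarrow> 'a \<Rightarrow> 'a list \<Rightarrow> bool" where
  "walk E u v p \<longleftrightarrow> p \<noteq> [] \<and> hd p = u \<and> last p = v \<and> successively (\<lambda>x y. {x, y} \<in> E) p"

definition cycle :: "'a set set \<Rightarrow> 'a list \<Rightarrow> bool" where
  "cycle E p \<longleftrightarrow> length p \<ge> 3 \<and> distinct p \<and> successively (\<lambda>x y. {x, y} \<in> E) p \<and> {last p, hd p} \<in> E"

definition undirected_tree :: "'a set \<Rightarrow> 'a set set \<Rightarrow> bool" where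
  "undirected_tree V E \<longleftrightarrow>
     V \<noteq> {} \<and>
     E \<subseteq> {{u, v} |u v. u \<in> V \<and> v \<in> V \<and> u \<noteq> v} \<and>
     (\<forall>u\<in>V. \<forall>v\<in>V. \<exists>p. walk E u v p) \<and>
     (\<nexists>p. cycle E p)"

definition walk_length :: "('a set \<Rightarrow> real) \<Rightarrow> 'a list \<Rightarrow> real" where
  "walk_length w p = (\<Sum>i<length p - 1. w {p ! i, p ! Suc i})"

definition shortest_path :: "'a set set \<Rightarrow> ('a set \<Rightarrow> real) \<Rightarrow> 'a \<Rightarrow> 'a \<Rightarrow> real" where
  "shortest_path E w u v = (INF p\<in>{p. walk E u v p}. walk_length w p)"

definition tree_metric :: "'a set \<Rightarrow> ('a \<Rightarrow> 'a \<Rightarrow> real) \<Rightarrow> bool" where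
  "tree_metric X d \<longleftrightarrow>
     (\<exists>E w. undirected_tree X E \<and> (\<forall>e\<in>E. w e > 0) \<and>
            (\<forall>u\<in>X. \<forall>v\<in>X. d u v = shortest_path E w u v))"


section \<open>The \<open>(h,k)\<close>-server problem\<close>

text \<open>Throughout, \<open>(X, d)\<close> is a metric space and all servers start at \<open>r \<in> X\<close>. A configuration of
  \<open>k\<close> servers is a function on \<open>nat\<close> of which only the values on \<open>{..<k}\<close> matter. In a schedule \<open>S\<close>,
  \<open>S 0\<close> is the initial configuration and \<open>S (Suc t)\<close> the configuration after the request \<open>\<sigma> ! t\<close>
  has been served.\<close>

definition schedule :: "'a set \<Rightarrow> 'a \<Rightarrow> nat \<Rightarrow> 'a list \<Rightarrow> (nat \<Rightarrow> nat \<Rightarrow> 'a) \<Rightarrow> bool" where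
  "schedule X r k \<sigma> S \<longleftrightarrow>
     (\<forall>i<k. S 0 i = r) \<and>
     (\<forall>t\<le>length \<sigma>. \<forall>i<k. S t i \<in> X) \<and>
     (\<forall>t<length \<sigma>. \<exists>i<k. S (Suc t) i = \<sigma> ! t)"

definition schedule_cost :: "('a \<Rightarrow> 'a \<Rightarrow> real) \<Rightarrow> nat \<Rightarrow> 'a list \<Rightarrow> (nat \<Rightarrow> nat \<Rightarrow> 'a) \<Rightarrow> real" where
  "schedule_cost d k \<sigma> S = (\<Sum>t<length \<sigma>. \<Sum>i<k. d (S t i) (S (Suc t) i))"

text \<open>Meaningful for \<open>h \<ge> 1\<close>, where schedules exist.\<close>

definition OPT :: "'a set \<Rightarrow> ('a \<Rightarrow> 'a \<Rightarrow> real) \<Rightarrow> 'a \<Rightarrow> nat \<Rightarrow> 'a list \<Rightarrow> real" where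
  "OPT X d r h \<sigma> = (INF S\<in>{S. schedule X r h \<sigma> S}. schedule_cost d h \<sigma> S)"

text \<open>A deterministic online algorithm maps the requests seen so far to its current configuration;
  its run on \<open>\<sigma>\<close> is the schedule of its values on the prefixes of \<open>\<sigma>\<close>.\<close>

type_synonym 'a algorithm = "'a list \<Rightarrow> nat \<Rightarrow> 'a"

definition run :: "'a algorithm \<Rightarrow> 'a list \<Rightarrow> nat \<Rightarrow> nat \<Rightarrow> 'a" where
  "run A \<sigma> t = A (take t \<sigma>)"

definition online_algorithm :: "'a set \<Rightarrow> 'a \<Rightarrow> nat \<Rightarrow> 'a algorithm \<Rightarrow> bool" where
  "online_algorithm X r k A \<longleftrightarrow> (\<forall>\<sigma>\<in>lists X. schedule X r k \<sigma> (run A \<sigma>))"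

definition borel_on :: "'a set \<Rightarrow> ('a \<Rightarrow> 'a \<Rightarrow> real) \<Rightarrow> 'a measure" where
  "borel_on X d = sigma X {U. openin (Metric_space.mtopology X d) U}"

text \<open>A randomized online algorithm is a probability distribution over deterministic online
  algorithms for which all server positions are random variables. Taking the algorithms themselves
  as outcomes is no restriction: an algorithm driven by a random seed from any other probability
  space is represented by its distribution. The \<open>\<sigma>\<close>-algebra of \<open>M\<close> is not prescribed.\<close>

definition randomized_algorithm ::
    "'a set \<Rightarrow> ('a \<Rightarrow> 'a \<Rightarrow> real) \<Rightarrow> 'a \<Rightarrow> nat \<Rightarrow> 'a algorithm measure \<Rightarrow> bool" where
  "randomized_algorithm X d r k M \<longleftrightarrow>
     prob_space M \<and>
     (\<forall>A\<in>space M. online_algorithm X r k A) \<and>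
     (\<forall>\<sigma>\<in>lists X. \<forall>i<k. (\<lambda>A. A \<sigma> i) \<in> M \<rightarrow>\<^sub>M borel_on X d)"

text \<open>Without integrability the Bochner integral would be 0; a cost of infinite expectation must not
  count as competitive.\<close>

definition competitive ::
    "'a set \<Rightarrow> ('a \<Rightarrow> 'a \<Rightarrow> real) \<Rightarrow> 'a \<Rightarrow> nat \<Rightarrow> nat \<Rightarrow> real \<Rightarrow> 'a algorithm measure \<Rightarrow> bool" where
  "competitive X d r h k \<rho> M \<longleftrightarrow>
     (\<exists>C\<ge>0. \<forall>\<sigma>\<in>lists X.
        integrable M (\<lambda>A. schedule_cost d k \<sigma> (run A \<sigma>)) \<and>
        (\<integral>A. schedule_cost d k \<sigma> (run A \<sigma>) \<partial>M) \<le> \<rho> * OPT X d r h \<sigma> + C)"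

text \<open>The infimum is taken in \<open>ereal\<close>, so that it is \<open>\<infinity>\<close> if no algorithm is competitive.\<close>

definition competitive_ratio :: "'a set \<Rightarrow> ('a \<Rightarrow> 'a \<Rightarrow> real) \<Rightarrow> 'a \<Rightarrow> nat \<Rightarrow> nat \<Rightarrow> ereal" where
  "competitive_ratio X d r h k =
     Inf {ereal \<rho> |\<rho>. \<exists>M. randomized_algorithm X d r k M \<and> competitive X d r h k \<rho> M}"

end

theory Submission
  imports Defs "HOL-Library.Nat_Bijection" "HOL-Library.Sublist"
begin

text \<open>
  The tree has vertices the finite sequences of natural numbers, and the edge leading down to a
  vertex of depth \<open>l\<close> has length \<open>2\<close> to the power \<open>-l\<close>.

  The requests come from a recursive random strategy. At level \<open>0\<close> it requests the vertex \<open>c\<close>. At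
  level \<open>n + 1\<close> it plays rounds, each of which plays level \<open>n\<close> in \<open>s\<close> children of \<open>c\<close>; after each
  round a fair coin decides whether to stop, for at most \<open>m\<close> coins. This is a ski rental problem:
  online, buying means moving servers down the edge to \<open>c\<close>, and renting means paying in the
  children. Each server inside the subtree saves at most half the length of the edge to \<open>c\<close> per
  round and the expected number of rounds is \<open>2\<close>, so whatever the algorithm does, it pays the
  length of that edge for each of the \<open>s^n\<close> leaves, except for the servers that are already there.

  The offline player knows the number of rounds. It rents with \<open>s^n\<close> servers if the game stops before
  the last coin and otherwise covers all \<open>s^(n+1)\<close> leaves at once, which makes its cost, relative to
  the online cost, decrease with every level. With \<open>s = 2^m\<close>, the ratio after \<open>2^m\<close> levels is
  \<open>\<Omega>(m)\<close>, while only \<open>h = 2^(m 2^m)\<close> offline servers are needed. Playing many phases in distinct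
  children of the root makes the additive constant and the number \<open>k\<close> of servers irrelevant.
\<close>

section \<open>The tree metric\<close>

declare list_encode.simps [simp del] list_decode.simps [simp del]

section \<open>Walks and shortest paths in arbitrary weighted graphs\<close>

lemma walk_length_singleton [simp]: "walk_length w [x] = 0"
  by (simp add: walk_length_def)

lemma walk_length_Cons [simp]: "walk_length w (x # y # p) = w {x, y} + walk_length w (y # p)"
  by (simp add: walk_length_def sum.lessThan_Suc_shift del: sum.lessThan_Suc)

lemma walk_singleton [simp]: "walk E u v [x] \<longleftrightarrow> x = u \<and> x = v"
  by (auto simp: walk_def)

lemma walk_Cons [simp]: "walk E u v (x # y # p) \<longleftrightarrow> x = u \<and> {x, y} \<in> E \<and> walk E y v (y # p)"
  by (auto simp: walk_def)

lemma not_walk_Nil [simp]: "\<not> walk E u v []"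
  by (simp add: walk_def)

lemma walk_append:
  assumes "walk E u v p" "walk E v z q"
  shows "walk E u z (p @ tl q)" "walk_length w (p @ tl q) = walk_length w p + walk_length w q"
proof -
  have "walk E u z (p @ tl q) \<and> walk_length w (p @ tl q) = walk_length w p + walk_length w q"
    using assms
  proof (induction p arbitrary: u rule: induct_list012)
    case (2 x)
    then have "[x] @ tl q = q"
      by (cases q) (auto simp: walk_def)
    then show ?case
      using 2 by auto
  qed auto
  then show "walk E u z (p @ tl q)" "walk_length w (p @ tl q) = walk_length w p + walk_length w q"
    by auto
qed

lemma walk_rev: "walk E u v p \<Longrightarrow> walk E v u (rev p)"
  by (auto simp: walk_def hd_rev last_rev successively_rev insert_commute)

text \<open>The triangle inequality adds up the edge bounds along the walk. This is the tool for
  bounding tree distances from below, by comparison with an explicit \<open>g\<close>.\<close>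

lemma walk_length_ge:
  assumes "walk E u v p"
    and refl: "\<And>x. g x x = 0" and tri: "\<And>x y z. g x z \<le> g x y + g y z"
    and edge: "\<And>x y. {x, y} \<in> E \<Longrightarrow> g x y \<le> (w {x, y} :: real)"
  shows "g u v \<le> walk_length w p"
  using assms(1)
proof (induction p arbitrary: u rule: induct_list012)
  case (3 x y p)
  then have "{x, y} \<in> E" "g y v \<le> walk_length w (y # p)" "x = u"
    by auto
  then show ?case
    using edge[of x y] tri[of x v y] by simp
qed (auto simp: refl)

lemma shortest_path_ge:
  assumes "walk E u v p"
    and "\<And>x. g x x = 0" "\<And>x y z. g x z \<le> g x y + g y z"
    and "\<And>x y. {x, y} \<in> E \<Longrightarrow> g x y \<le> (w {x, y} :: real)"
  shows "g u v \<le> shortest_path E w u v"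
  unfolding shortest_path_def
  by (rule cINF_greatest) (use assms walk_length_ge[of E _ _ _ g w] in auto)

lemma walk_length_nonneg:
  assumes "walk E u v p" "\<And>e. e \<in> E \<Longrightarrow> w e \<ge> 0"
  shows "walk_length w p \<ge> 0"
  using walk_length_ge[of E u v p "\<lambda>_ _. 0" w] assms by auto

lemma shortest_path_le:
  assumes "walk E u v p" "\<And>e. e \<in> E \<Longrightarrow> w e \<ge> 0"
  shows "shortest_path E w u v \<le> walk_length w p"
proof -
  have "bdd_below (walk_length w ` {p. walk E u v p})"
    by (rule bdd_belowI2[of _ 0]) (use walk_length_nonneg[OF _ assms(2)] in auto)
  then show ?thesis
    unfolding shortest_path_def by (rule cINF_lower) (use assms(1) in simp)
qed

lemma shortest_path_triangle:
  assumes "\<And>x y. \<exists>p. walk E x y p" "\<And>e. e \<in> E \<Longrightarrow> w e \<ge> 0"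
  shows "shortest_path E w u z \<le> shortest_path E w u v + shortest_path E w v z"
proof -
  have *: "shortest_path E w u z - walk_length w q \<le> walk_length w p"
    if "walk E u v p" "walk E v z q" for p q
  proof -
    have "shortest_path E w u z \<le> walk_length w (p @ tl q)"
      by (rule shortest_path_le) (use that walk_append(1) assms(2) in auto)
    then show ?thesis
      by (simp add: walk_append(2)[OF that])
  qed
  have "shortest_path E w u z - shortest_path E w u v \<le> walk_length w q" if "walk E v z q" for q
  proof -
    have "shortest_path E w u z - walk_length w q \<le> shortest_path E w u v"
      unfolding shortest_path_def[of E w u v]
      by (rule cINF_greatest) (use assms(1) *[OF _ that] in auto)
    then show ?thesis
      by simp
  qed
  then have "shortest_path E w u z - shortest_path E w u v \<le> shortest_path E w v z"
    unfolding shortest_path_def[of E w v z]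
    by (intro cINF_greatest) (use assms(1) in auto)
  then show ?thesis
    by simp
qed

section \<open>The infinite tree of finite sequences of naturals\<close>

definition depth :: "nat \<Rightarrow> nat" where
  "depth u = length (list_decode u)"

text \<open>\<open>list_encode\<close> is a bijection, so every natural number is a vertex. Every
  vertex has infinitely many children, which supplies fresh subtrees for any number of
  phases.\<close>

definition tree_edges :: "nat set set" where
  "tree_edges = {{list_encode xs, list_encode (xs @ [i])} |xs i. True}"

text \<open>The maximum picks the lower end of the edge, so the weight can be read off an unordered
  pair.\<close>

definition edge_weight :: "nat set \<Rightarrow> real" where
  "edge_weight e = (1/2) ^ Max (depth ` e)"

definition tree_dist :: "nat \<Rightarrow> nat \<Rightarrow> real" where
  "tree_dist = shortest_path tree_edges edge_weight"

lemma edge_weight_pos: "edge_weight e > 0"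
  by (simp add: edge_weight_def)

lemma edge_weight_nonneg [simp]: "edge_weight e \<ge> 0"
  using edge_weight_pos less_imp_le by blast

lemma edge_weight_edge [simp]:
  "edge_weight {list_encode xs, list_encode (xs @ [i])} = (1/2) ^ Suc (length xs)"
  by (simp add: edge_weight_def depth_def)

lemma tree_edges_iff:
  "{u, v} \<in> tree_edges \<longleftrightarrow>
     (\<exists>xs i. u = list_encode xs \<and> v = list_encode (xs @ [i])) \<or>
     (\<exists>xs i. v = list_encode xs \<and> u = list_encode (xs @ [i]))"
  unfolding tree_edges_def by (auto simp: doubleton_eq_iff)

lemma ex_walk_from_root: "\<exists>p. walk tree_edges (list_encode []) (list_encode xs) p"
proof (induction xs rule: rev_induct)
  case Nil
  have "walk tree_edges (list_encode []) (list_encode []) [list_encode []]"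
    by simp
  then show ?case
    by blast
next
  case (snoc i xs)
  then obtain p where "walk tree_edges (list_encode []) (list_encode xs) p"
    by blast
  moreover have "walk tree_edges (list_encode xs) (list_encode (xs @ [i]))
      [list_encode xs, list_encode (xs @ [i])]"
    unfolding walk_Cons walk_singleton tree_edges_iff by blast
  ultimately show ?case
    using walk_append(1)[where E = tree_edges] by metis
qed

lemma ex_walk: "\<exists>p. walk tree_edges u v p"
proof -
  obtain p q where "walk tree_edges (list_encode []) u p" "walk tree_edges (list_encode []) v q"
    using ex_walk_from_root list_decode_inverse by metis
  then have "walk tree_edges u v (rev p @ tl q)"
    by (intro walk_append(1)[OF walk_rev])
  then show ?thesis
    by blast
qed

text \<open>Both cycle neighbours of a deepest vertex would have to be its parent, hence coincide,
  which is impossible on a cycle of at least three distinct vertices.\<close>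

lemma not_cycle_tree_edges: "\<not> cycle tree_edges p"
proof
  assume "cycle tree_edges p"
  then have len: "length p \<ge> 3" and dist: "distinct p"
    and succ: "successively (\<lambda>x y. {x, y} \<in> tree_edges) p"
    and close: "{last p, hd p} \<in> tree_edges"
    by (auto simp: cycle_def)
  define L where "L = length p"
  have adj: "{p ! j, p ! (Suc j mod L)} \<in> tree_edges" if "j < L" for j
  proof (cases "Suc j = L")
    case True
    then have "j = L - 1" "p \<noteq> []"
      using len by auto
    then have "p ! j = last p" "p ! (Suc j mod L) = hd p"
      using True by (simp_all add: L_def last_conv_nth hd_conv_nth)
    then show ?thesis
      using close by simp
  next
    case False
    then show ?thesis
      using that succ by (auto simp: L_def successively_conv_nth)
  qed
  let ?D = "(\<lambda>j. depth (p ! j)) ` {..<L}"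
  have "0 < L"
    using len L_def by linarith
  then have "Max ?D \<in> ?D"
    by (intro Max_in) auto
  then obtain j where "j < L" and Max: "Max ?D = depth (p ! j)"
    by auto
  have j: "j < L" "\<And>i. i < L \<Longrightarrow> depth (p ! i) \<le> depth (p ! j)"
    using \<open>j < L\<close> by (auto simp flip: Max)
  have parent: "v = list_encode (butlast (list_decode (p ! j)))"
    if "{p ! j, v} \<in> tree_edges" "depth v \<le> depth (p ! j)" for v
    using that unfolding tree_edges_iff depth_def by auto
  \<comment> \<open>The cyclic predecessor of \<open>j\<close>; adding \<open>L - 1\<close> instead
    of subtracting 1 also works for \<open>j = 0\<close>.\<close>
  define i where "i = (j + (L - 1)) mod L"
  have L3: "L \<ge> 3"
    using len L_def by simp
  have "i < L"
    using L3 by (simp add: i_def)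
  have "Suc i mod L = Suc (j + (L - 1)) mod L"
    by (simp add: i_def mod_Suc_eq)
  also have "Suc (j + (L - 1)) = j + L"
    using L3 by simp
  finally have i: "i < L" "Suc i mod L = j"
    using j(1) \<open>i < L\<close> by simp_all
  have "Suc j mod L < L"
    using L3 by simp
  then have "p ! i = p ! (Suc j mod L)"
    using parent[of "p ! i"] parent[of "p ! (Suc j mod L)"] adj[OF i(1)] adj[OF j(1)] i j
    by (simp add: insert_commute)
  then have "i = Suc j mod L"
    using dist i(1) \<open>Suc j mod L < L\<close> by (simp add: L_def nth_eq_iff_index_eq)
  then have "Suc (Suc j) mod L = j"
    using i(2) by (simp add: mod_Suc_eq)
  moreover have "Suc (Suc j) mod L = (if Suc (Suc j) < L then Suc (Suc j) else Suc (Suc j) - L)"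
    using L3 j(1) by (simp add: mod_if)
  ultimately show False
    using L3 j(1) by (simp split: if_splits)
qed

lemma undirected_tree_tree_edges: "undirected_tree UNIV tree_edges"
proof -
  have "xs \<noteq> xs @ [i]" for xs :: "nat list" and i
    by simp
  then have "tree_edges \<subseteq> {{u, v} |u v. u \<in> UNIV \<and> v \<in> UNIV \<and> u \<noteq> v}"
    unfolding tree_edges_def
    by clarify (metis UNIV_I list_encode_inverse)
  then show ?thesis
    using ex_walk not_cycle_tree_edges by (simp add: undirected_tree_def)
qed

lemma tree_metric_tree_dist: "tree_metric UNIV tree_dist"
  unfolding tree_metric_def tree_dist_def
  by (intro exI[of _ tree_edges] exI[of _ edge_weight])
    (simp add: undirected_tree_tree_edges edge_weight_pos)

lemma tree_dist_triangle: "tree_dist u z \<le> tree_dist u v + tree_dist v z"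
  unfolding tree_dist_def
  by (rule shortest_path_triangle) (auto simp: ex_walk)

lemma tree_dist_nonneg [simp]: "tree_dist u v \<ge> 0"
proof -
  obtain p where "walk tree_edges u v p"
    using ex_walk by blast
  from shortest_path_ge[OF this, of "\<lambda>_ _. 0" edge_weight] show ?thesis
    by (simp add: tree_dist_def)
qed

lemma tree_dist_same [simp]: "tree_dist u u = 0"
proof -
  have "tree_dist u u \<le> walk_length edge_weight [u]"
    unfolding tree_dist_def
    by (rule shortest_path_le) auto
  then show ?thesis
    using tree_dist_nonneg[of u u] by simp
qed

lemma walk_length_snoc: "walk_length w (p @ [y, x]) = walk_length w (p @ [y]) + w {y, x}"
  by (induction p rule: induct_list012) auto

lemma walk_length_rev: "walk_length w (rev p) = walk_length w p"
proof (induction p rule: induct_list012)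
  case (3 x y p)
  then show ?case
    using walk_length_snoc[of w "rev p" y x] by (simp add: insert_commute)
qed (auto simp: walk_length_def)

lemma tree_dist_commute_le: "tree_dist u v \<le> tree_dist v u"
proof -
  have "shortest_path tree_edges edge_weight u v \<le> walk_length edge_weight p"
    if "walk tree_edges v u p" for p
    using shortest_path_le[OF walk_rev[OF that], of edge_weight] by (simp add: walk_length_rev)
  then show ?thesis
    unfolding tree_dist_def shortest_path_def[of _ _ v u]
    using ex_walk by (intro cINF_greatest) auto
qed

lemma tree_dist_commute: "tree_dist u v = tree_dist v u"
  using tree_dist_commute_le antisym by blast

lemma tree_dist_child: "tree_dist (list_encode xs) (list_encode (xs @ [i])) \<le> (1/2) ^ Suc (length xs)"
proof -
  have "walk tree_edges (list_encode xs) (list_encode (xs @ [i]))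
      [list_encode xs, list_encode (xs @ [i])]"
    unfolding walk_Cons walk_singleton tree_edges_iff by blast
  from shortest_path_le[OF this, of edge_weight] show ?thesis
    by (simp add: tree_dist_def)
qed

text \<open>The edges on the way down form a telescoping geometric series. So a whole subtree,
  however deep, lies within the length of the edge above its top, which keeps covering all leaves
  cheap.\<close>

lemma tree_dist_descendant:
  "tree_dist (list_encode xs) (list_encode (xs @ ys)) \<le> (1/2) ^ length xs - (1/2) ^ length (xs @ ys)"
proof (induction ys rule: rev_induct)
  case (snoc i ys)
  then show ?case
    using tree_dist_triangle[of "list_encode xs" "list_encode (xs @ ys @ [i])" "list_encode (xs @ ys)"]
      tree_dist_child[of "xs @ ys" i] by simp
qed simp


section \<open>Randomized request strategies\<close>

text \<open>An oblivious adversary with finitely many fair coins. Its expectations are finite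
  averages, computed by \<open>expect\<close> in continuation style, so they need no measure
  theory.\<close>

datatype 'a strategy =
    Stop
  | Request 'a
  | Seq "'a strategy" "'a strategy"
  | Coin "'a strategy" "'a strategy"

primrec expect :: "'a strategy \<Rightarrow> ('a list \<Rightarrow> real) \<Rightarrow> real" where
  "expect Stop f = f []"
| "expect (Request r) f = f [r]"
| "expect (Seq G H) f = expect G (\<lambda>\<tau>. expect H (\<lambda>\<tau>'. f (\<tau> @ \<tau>')))"
| "expect (Coin G H) f = (expect G f + expect H f) / 2"

primrec seqs :: "nat \<Rightarrow> (nat \<Rightarrow> 'a strategy) \<Rightarrow> 'a strategy" where
  "seqs 0 G = Stop"
| "seqs (Suc l) G = Seq (seqs l G) (G l)"

text \<open>The two rounds at the end keep the expected number of remaining rounds at 2 throughout,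
  although the number of coins is bounded.\<close>

primrec rounds :: "nat \<Rightarrow> 'a strategy \<Rightarrow> 'a strategy" where
  "rounds 0 R = Seq R R"
| "rounds (Suc j) R = Seq R (Coin Stop (rounds j R))"

primrec game :: "nat \<Rightarrow> nat \<Rightarrow> nat \<Rightarrow> nat list \<Rightarrow> nat strategy" where
  "game m s 0 c = Request (list_encode c)"
| "game m s (Suc n) c = rounds m (seqs s (\<lambda>i. game m s n (c @ [i])))"

lemma expect_const [simp]: "expect G (\<lambda>_. b) = b"
  by (induction G) auto

lemma expect_add: "expect G (\<lambda>\<tau>. f \<tau> + g \<tau>) = expect G f + expect G g"
  by (induction G arbitrary: f g) (auto simp: add_divide_distrib)

lemma expect_cmult: "expect G (\<lambda>\<tau>. b * f \<tau>) = b * expect G f"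
  by (induction G arbitrary: f) (auto simp: algebra_simps add_divide_distrib)

lemma expect_diff: "expect G (\<lambda>\<tau>. f \<tau> - g \<tau>) = expect G f - expect G g"
  using expect_add[of G f "\<lambda>\<tau>. - 1 * g \<tau>"] expect_cmult[of G "- 1" g] by simp

lemma expect_sum: "expect G (\<lambda>\<tau>. \<Sum>i\<in>I. f i \<tau>) = (\<Sum>i\<in>I. expect G (f i))"
  by (induction I rule: infinite_finite_induct) (auto simp: expect_add)

text \<open>The restriction to \<open>set_strategy G\<close> matters offline: covering the leaves
  helps only if all requests are leaves.\<close>

lemma expect_mono:
  assumes "\<And>\<tau>. set \<tau> \<subseteq> set_strategy G \<Longrightarrow> f \<tau> \<le> g \<tau>"
  shows "expect G f \<le> expect G g"
  using assms
proof (induction G arbitrary: f g)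
  case (Seq G H)
  have "f (\<tau> @ \<tau>') \<le> g (\<tau> @ \<tau>')" if "set \<tau> \<subseteq> set_strategy G" "set \<tau>' \<subseteq> set_strategy H" for \<tau> \<tau>'
    by (rule Seq.prems) (use that in auto)
  then show ?case
    by (auto intro!: Seq.IH)
next
  case (Coin G H)
  have "expect G f \<le> expect G g" "expect H f \<le> expect H g"
    by (rule Coin.IH; use Coin.prems in auto)+
  then show ?case
    by simp
qed auto

text \<open>A strategy involves only finite averages, so linearity of the integral is enough to
  exchange the randomness of the algorithm with that of the adversary.\<close>

lemma expect_integral:
  assumes "\<And>\<tau>. integrable M (f \<tau>)"
  shows "integrable M (\<lambda>x. expect G (\<lambda>\<tau>. f \<tau> x))"
    and "(\<integral>x. expect G (\<lambda>\<tau>. f \<tau> x) \<partial>M) = expect G (\<lambda>\<tau>. \<integral>x. f \<tau> x \<partial>M)"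
proof -
  have "integrable M (\<lambda>x. expect G (\<lambda>\<tau>. f \<tau> x)) \<and>
      (\<integral>x. expect G (\<lambda>\<tau>. f \<tau> x) \<partial>M) = expect G (\<lambda>\<tau>. \<integral>x. f \<tau> x \<partial>M)"
    using assms
  proof (induction G arbitrary: f)
    case (Seq G H)
    have H: "integrable M (\<lambda>x. expect H (\<lambda>\<tau>'. f (\<tau> @ \<tau>') x)) \<and>
      (\<integral>x. expect H (\<lambda>\<tau>'. f (\<tau> @ \<tau>') x) \<partial>M) = expect H (\<lambda>\<tau>'. \<integral>x. f (\<tau> @ \<tau>') x \<partial>M)" for \<tau>
      by (rule Seq.IH(2)) (rule Seq.prems)
    show ?case
      using Seq.IH(1)[of "\<lambda>\<tau> x. expect H (\<lambda>\<tau>'. f (\<tau> @ \<tau>') x)"] H by simp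
  qed auto
  then show "integrable M (\<lambda>x. expect G (\<lambda>\<tau>. f \<tau> x))"
    and "(\<integral>x. expect G (\<lambda>\<tau>. f \<tau> x) \<partial>M) = expect G (\<lambda>\<tau>. \<integral>x. f \<tau> x \<partial>M)"
    by auto
qed

text \<open>Whatever raises the potential \<open>x\<close> before component \<open>i\<close> is
  played has been paid for in \<open>K\<close>, and later components cannot lower the total. So the
  bound for one component survives for the whole sequence.\<close>

lemma expect_seqs_ge:
  fixes K :: "'a list \<Rightarrow> 'a list \<Rightarrow> real"
  assumes add: "\<And>\<sigma> \<tau> \<tau>'. K \<sigma> (\<tau> @ \<tau>') = K \<sigma> \<tau> + K (\<sigma> @ \<tau>) \<tau>'"
    and nonneg: "\<And>\<sigma> \<tau>. K \<sigma> \<tau> \<ge> 0"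
    and pot: "\<And>\<sigma> \<tau>. x (\<sigma> @ \<tau>) \<le> x \<sigma> + K \<sigma> \<tau>"
    and "i < l" and G: "\<And>\<sigma>. expect (G i) (K \<sigma>) \<ge> N - x \<sigma>"
  shows "expect (seqs l G) (K \<sigma>) \<ge> N - x \<sigma>"
  using \<open>i < l\<close>
proof (induction l)
  case (Suc l)
  have eq: "expect (seqs (Suc l) G) (K \<sigma>) =
      expect (seqs l G) (\<lambda>\<tau>. K \<sigma> \<tau> + expect (G l) (K (\<sigma> @ \<tau>)))"
    by (simp add: add expect_add)
  show ?case
  proof (cases "i = l")
    case True
    have "N - x \<sigma> = expect (seqs l G) (\<lambda>_. N - x \<sigma>)"
      by simp
    also have "\<dots> \<le> expect (seqs (Suc l) G) (K \<sigma>)"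
      unfolding eq
    proof (rule expect_mono)
      fix \<tau>
      show "N - x \<sigma> \<le> K \<sigma> \<tau> + expect (G l) (K (\<sigma> @ \<tau>))"
        using pot[of \<sigma> \<tau>] G[of "\<sigma> @ \<tau>"] True by simp
    qed
    finally show ?thesis .
  next
    case False
    have "0 \<le> expect (G l) (K \<sigma>')" for \<sigma>'
      using expect_mono[of "G l" "\<lambda>_. 0"] nonneg by simp
    then have "expect (seqs l G) (K \<sigma>) \<le> expect (seqs (Suc l) G) (K \<sigma>)"
      unfolding eq by (intro expect_mono) simp
    then show ?thesis
      using False Suc by simp
  qed
qed simp

text \<open>Here \<open>y\<close> is the amount already bought, \<open>T\<close> the cost of buying and \<open>K\<close> the rent. A unit of
  \<open>y\<close> saves at most half a unit per round, and the expected number of rounds is 2.\<close>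

lemma expect_rounds_ge:
  fixes T K :: "'a list \<Rightarrow> 'a list \<Rightarrow> real"
  assumes addT: "\<And>\<sigma> \<tau> \<tau>'. T \<sigma> (\<tau> @ \<tau>') = T \<sigma> \<tau> + T (\<sigma> @ \<tau>) \<tau>'"
    and addK: "\<And>\<sigma> \<tau> \<tau>'. K \<sigma> (\<tau> @ \<tau>') = K \<sigma> \<tau> + K (\<sigma> @ \<tau>) \<tau>'"
    and Nil: "\<And>\<sigma>. T \<sigma> [] = 0" "\<And>\<sigma>. K \<sigma> [] = 0"
    and nonneg: "\<And>\<sigma> \<tau>. T \<sigma> \<tau> \<ge> 0"
    and pot: "\<And>\<sigma> \<tau>. y (\<sigma> @ \<tau>) \<le> y \<sigma> + T \<sigma> \<tau>"
    and R: "\<And>\<sigma>. expect R (K \<sigma>) \<ge> (N - y \<sigma>) / 2"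
  shows "expect (rounds j R) (\<lambda>\<tau>. T \<sigma> \<tau> + K \<sigma> \<tau>) \<ge> N - y \<sigma>"
proof -
  have R': "expect R (\<lambda>\<tau>. T \<sigma> \<tau> + K \<sigma> \<tau>) \<ge> (N - y \<sigma>) / 2 + expect R (T \<sigma>)" for \<sigma>
    using R[of \<sigma>] by (simp add: expect_add)
  \<comment> \<open>\<open>H\<close> is whatever follows the first round. The first round yields one
    half of \<open>N - y \<sigma>\<close>, and \<open>H\<close> yields the other half, up to what
    the first round has bought, which \<open>T\<close> pays.\<close>
  have step: "N - y \<sigma> \<le> expect (Seq R H) (\<lambda>\<tau>. T \<sigma> \<tau> + K \<sigma> \<tau>)"
    if H: "\<And>\<sigma>. expect H (\<lambda>\<tau>. T \<sigma> \<tau> + K \<sigma> \<tau>) \<ge> (N - y \<sigma>) / 2" for H \<sigma>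
  proof -
    have "N - y \<sigma> \<le> expect R (\<lambda>\<tau>. T \<sigma> \<tau> + K \<sigma> \<tau>) - expect R (T \<sigma>) + (N - y \<sigma>) / 2"
      using R'[of \<sigma>] by argo
    also have "\<dots> = expect R (\<lambda>\<tau>. T \<sigma> \<tau> + K \<sigma> \<tau> + ((N - y \<sigma>) / 2 - T \<sigma> \<tau>))"
      by (simp add: expect_add expect_diff)
    also have "\<dots> \<le> expect R (\<lambda>\<tau>. T \<sigma> \<tau> + K \<sigma> \<tau> +
        expect H (\<lambda>\<tau>'. T (\<sigma> @ \<tau>) \<tau>' + K (\<sigma> @ \<tau>) \<tau>'))"
    proof (rule expect_mono)
      fix \<tau>
      have "(N - y \<sigma>) / 2 - T \<sigma> \<tau> \<le> (N - y (\<sigma> @ \<tau>)) / 2"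
        using pot[of \<sigma> \<tau>] nonneg[of \<sigma> \<tau>] by argo
      also have "\<dots> \<le> expect H (\<lambda>\<tau>'. T (\<sigma> @ \<tau>) \<tau>' + K (\<sigma> @ \<tau>) \<tau>')"
        by (rule H)
      finally show "T \<sigma> \<tau> + K \<sigma> \<tau> + ((N - y \<sigma>) / 2 - T \<sigma> \<tau>) \<le> T \<sigma> \<tau> + K \<sigma> \<tau> +
        expect H (\<lambda>\<tau>'. T (\<sigma> @ \<tau>) \<tau>' + K (\<sigma> @ \<tau>) \<tau>')"
        by linarith
    qed
    also have "\<dots> = expect (Seq R H) (\<lambda>\<tau>. T \<sigma> \<tau> + K \<sigma> \<tau>)"
      by (simp add: addT addK expect_add)
    finally show ?thesis .
  qed
  have "\<And>\<sigma>. expect (rounds j R) (\<lambda>\<tau>. T \<sigma> \<tau> + K \<sigma> \<tau>) \<ge> N - y \<sigma>"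
  proof (induction j)
    case 0
    have "(N - y \<sigma>) / 2 \<le> expect R (\<lambda>\<tau>. T \<sigma> \<tau> + K \<sigma> \<tau>)" for \<sigma>
      using R'[of \<sigma>] expect_mono[of R "\<lambda>_. 0" "T \<sigma>"] nonneg by (simp add: field_simps)
    then show ?case
      using step[of R] by simp
  next
    case (Suc j)
    \<comment> \<open>Stopping contributes 0, so the fair coin halves the bound of the induction
      hypothesis.\<close>
    have "(N - y \<sigma>) / 2 \<le> expect (Coin Stop (rounds j R)) (\<lambda>\<tau>. T \<sigma> \<tau> + K \<sigma> \<tau>)" for \<sigma>
      using Suc[of \<sigma>] by (simp add: Nil)
    from step[OF this] show ?case
      by (simp only: rounds.simps)
  qed
  then show ?thesis .
qed


section \<open>The online cost\<close>

text \<open>For nonempty \<open>c\<close>, the edge above \<open>c\<close> separates two vertices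
  exactly if their values differ.\<close>

definition inside :: "nat list \<Rightarrow> nat \<Rightarrow> real" where
  "inside c u = of_bool (prefix c (list_decode u))"

abbreviation edge_len :: "nat list \<Rightarrow> real" where
  "edge_len c \<equiv> (1/2) ^ length c"

primrec nodes :: "nat \<Rightarrow> nat \<Rightarrow> nat list \<Rightarrow> nat list set" where
  "nodes s 0 c = {c}"
| "nodes s (Suc n) c = insert c (\<Union>i<s. nodes s n (c @ [i]))"

lemma finite_nodes [simp]: "finite (nodes s n c)"
  by (induction n arbitrary: c) auto

lemma prefix_nodes: "v \<in> nodes s n c \<Longrightarrow> prefix c v"
  by (induction n arbitrary: c) (auto dest: append_prefixD)

lemma nodes_disjoint: "i \<noteq> j \<Longrightarrow> nodes s n (c @ [i]) \<inter> nodes s n' (c @ [j]) = {}"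
  by (auto simp: prefix_def dest!: prefix_nodes)

lemma sum_nodes_Suc:
  fixes f :: "nat list \<Rightarrow> real"
  shows "sum f (nodes s (Suc n) c) = f c + (\<Sum>i<s. sum f (nodes s n (c @ [i])))"
proof -
  have "c \<notin> (\<Union>i<s. nodes s n (c @ [i]))"
    using prefix_nodes by fastforce
  moreover have "sum f (\<Union>i<s. nodes s n (c @ [i])) = (\<Sum>i<s. sum f (nodes s n (c @ [i])))"
    by (rule sum.UNION_disjoint) (auto simp: nodes_disjoint)
  ultimately show ?thesis
    by simp
qed

lemma sum_inside_children: "(\<Sum>i<s. inside (c @ [i]) u) \<le> inside c u"
proof (cases "\<exists>i ys. list_decode u = c @ i # ys")
  case True
  then obtain i ys where u: "list_decode u = c @ i # ys"
    by blast
  have "(\<Sum>j<s. inside (c @ [j]) u) = (\<Sum>j<s. if i = j then 1 else 0)"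
    by (intro sum.cong) (auto simp: inside_def u)
  also have "\<dots> \<le> 1"
    by (simp add: sum.delta')
  finally show ?thesis
    by (simp add: inside_def u)
next
  case False
  then have "inside (c @ [i]) u = 0" for i
    by (auto simp: inside_def prefix_def)
  then show ?thesis
    by (simp add: inside_def)
qed

context
  fixes k :: nat and A :: "nat algorithm"
begin

definition load :: "nat list \<Rightarrow> nat list \<Rightarrow> real" where
  "load c \<sigma> = (\<Sum>i<k. inside c (A \<sigma> i))"

text \<open>Counts the servers that cross the edge above \<open>c\<close> downwards from one
  configuration to the next, while \<open>\<tau>\<close> is served after the history
  \<open>\<sigma>\<close>.\<close>

primrec down :: "nat list \<Rightarrow> nat list \<Rightarrow> nat list \<Rightarrow> real" where
  "down c \<sigma> [] = 0"
| "down c \<sigma> (r # \<tau>) =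
     (\<Sum>i<k. max 0 (inside c (A (\<sigma> @ [r]) i) - inside c (A \<sigma> i))) + down c (\<sigma> @ [r]) \<tau>"

definition descent :: "nat \<Rightarrow> nat \<Rightarrow> nat list \<Rightarrow> nat list \<Rightarrow> nat list \<Rightarrow> real" where
  "descent s n c \<sigma> \<tau> = (\<Sum>v\<in>nodes s n c. edge_len v * down v \<sigma> \<tau>)"

lemma down_append: "down c \<sigma> (\<tau> @ \<tau>') = down c \<sigma> \<tau> + down c (\<sigma> @ \<tau>) \<tau>'"
  by (induction \<tau> arbitrary: \<sigma>) auto

lemma down_nonneg [simp]: "down c \<sigma> \<tau> \<ge> 0"
  by (induction \<tau> arbitrary: \<sigma>) (auto intro!: sum_nonneg add_nonneg_nonneg)

lemma load_le: "load c (\<sigma> @ \<tau>) \<le> load c \<sigma> + down c \<sigma> \<tau>"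
proof (induction \<tau> arbitrary: \<sigma>)
  case (Cons r \<tau>)
  have "load c (\<sigma> @ [r]) - load c \<sigma> \<le> (\<Sum>i<k. max 0 (inside c (A (\<sigma> @ [r]) i) - inside c (A \<sigma> i)))"
    unfolding load_def sum_subtractf[symmetric] by (rule sum_mono) simp
  then show ?case
    using Cons[of "\<sigma> @ [r]"] by simp
qed simp

lemma load_children: "(\<Sum>i<s. load (c @ [i]) \<sigma>) \<le> load c \<sigma>"
  unfolding load_def by (subst sum.swap) (intro sum_mono sum_inside_children)

lemma descent_append: "descent s n c \<sigma> (\<tau> @ \<tau>') = descent s n c \<sigma> \<tau> + descent s n c (\<sigma> @ \<tau>) \<tau>'"
  by (simp add: descent_def down_append algebra_simps sum.distrib)

lemma descent_nonneg: "descent s n c \<sigma> \<tau> \<ge> 0"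
  by (auto simp: descent_def intro!: sum_nonneg)

lemma descent_Suc:
  "descent s (Suc n) c \<sigma> \<tau> = edge_len c * down c \<sigma> \<tau> + (\<Sum>i<s. descent s n (c @ [i]) \<sigma> \<tau>)"
  unfolding descent_def by (rule sum_nodes_Suc)

lemma descent_ge_down: "edge_len c * down c \<sigma> \<tau> \<le> descent s n c \<sigma> \<tau>"
  by (cases n) (auto simp: descent_Suc descent_nonneg sum_nonneg, auto simp: descent_def)

text \<open>Induction on the level. A requested leaf needs a server, which was there before or has
  come down. Above that, buying is movement down the edge to \<open>c\<close>, renting is the
  descent in the children, and \<open>expect_rounds_ge\<close> combines them.\<close>

lemma expect_descent_game:
  assumes server: "\<And>\<sigma> r. \<exists>i<k. A (\<sigma> @ [r]) i = r"
  shows "expect (game m s n c) (descent s n c \<sigma>) \<ge> edge_len c * (real s ^ n - load c \<sigma>)"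
proof (induction n arbitrary: c \<sigma>)
  case 0
  obtain i where "i < k" "A (\<sigma> @ [list_encode c]) i = list_encode c"
    using server by blast
  then have "1 \<le> load c (\<sigma> @ [list_encode c])"
    using member_le_sum[of i "{..<k}" "\<lambda>i. inside c (A (\<sigma> @ [list_encode c]) i)"]
    by (simp add: load_def inside_def)
  then have "1 - load c \<sigma> \<le> down c \<sigma> [list_encode c]"
    using load_le[of c \<sigma> "[list_encode c]"] by linarith
  then have "edge_len c * (1 - load c \<sigma>) \<le> edge_len c * down c \<sigma> [list_encode c]"
    by (intro mult_left_mono) auto
  then show ?case
    by (simp add: descent_def)
next
  case (Suc n)
  define R where "R = seqs s (\<lambda>i. game m s n (c @ [i]))"
  define K where "K \<sigma> \<tau> = (\<Sum>i<s. descent s n (c @ [i]) \<sigma> \<tau>)" for \<sigma> \<tau>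
  have child: "expect R (descent s n (c @ [i]) \<sigma>) \<ge>
      edge_len c / 2 * real s ^ n - edge_len c / 2 * load (c @ [i]) \<sigma>" if "i < s" for i \<sigma>
    unfolding R_def
  proof (rule expect_seqs_ge[where x = "\<lambda>\<sigma>. edge_len c / 2 * load (c @ [i]) \<sigma>", OF _ _ _ \<open>i < s\<close>])
    fix \<sigma> \<tau>
    have "edge_len (c @ [i]) * load (c @ [i]) (\<sigma> @ \<tau>) \<le>
        edge_len (c @ [i]) * (load (c @ [i]) \<sigma> + down (c @ [i]) \<sigma> \<tau>)"
      by (intro mult_left_mono load_le) auto
    then show "edge_len c / 2 * load (c @ [i]) (\<sigma> @ \<tau>) \<le>
        edge_len c / 2 * load (c @ [i]) \<sigma> + descent s n (c @ [i]) \<sigma> \<tau>"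
      using descent_ge_down[of "c @ [i]" \<sigma> \<tau> s n] by (simp add: algebra_simps)
  next
    fix \<sigma>
    show "edge_len c / 2 * real s ^ n - edge_len c / 2 * load (c @ [i]) \<sigma> \<le>
        expect (game m s n (c @ [i])) (descent s n (c @ [i]) \<sigma>)"
      using Suc[of "c @ [i]" \<sigma>] by (simp add: algebra_simps)
  qed (auto simp: descent_append descent_nonneg)
  \<comment> \<open>The edges above the children are half as long as the edge above
    \<open>c\<close>, and together the children hold at most \<open>load c \<sigma>\<close> servers.
    This is the rent per round that \<open>expect_rounds_ge\<close> asks for.\<close>
  have R: "expect R (K \<sigma>) \<ge> (edge_len c * real s ^ Suc n - edge_len c * load c \<sigma>) / 2" for \<sigma>
  proof -
    have "edge_len c / 2 * (\<Sum>i<s. load (c @ [i]) \<sigma>) \<le> edge_len c / 2 * load c \<sigma>"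
      by (intro mult_left_mono load_children) simp
    moreover have "(\<Sum>i<s. edge_len c / 2 * real s ^ n - edge_len c / 2 * load (c @ [i]) \<sigma>) =
        edge_len c / 2 * real s ^ Suc n - edge_len c / 2 * (\<Sum>i<s. load (c @ [i]) \<sigma>)"
      by (simp add: sum_subtractf sum_distrib_left)
    moreover have "(edge_len c * real s ^ Suc n - edge_len c * load c \<sigma>) / 2 =
        edge_len c / 2 * real s ^ Suc n - edge_len c / 2 * load c \<sigma>"
      by (simp only: diff_divide_distrib times_divide_eq_left)
    ultimately have "(edge_len c * real s ^ Suc n - edge_len c * load c \<sigma>) / 2 \<le>
        (\<Sum>i<s. edge_len c / 2 * real s ^ n - edge_len c / 2 * load (c @ [i]) \<sigma>)"
      by linarith
    also have "\<dots> \<le> (\<Sum>i<s. expect R (descent s n (c @ [i]) \<sigma>))"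
      by (intro sum_mono child) simp
    finally show ?thesis
      by (simp add: K_def[abs_def] expect_sum)
  qed
  have "edge_len c * real s ^ Suc n - edge_len c * load c \<sigma> \<le>
      expect (rounds m R) (\<lambda>\<tau>. edge_len c * down c \<sigma> \<tau> + K \<sigma> \<tau>)"
  proof (rule expect_rounds_ge[OF _ _ _ _ _ _ R])
    show "edge_len c * load c (\<sigma> @ \<tau>) \<le> edge_len c * load c \<sigma> + edge_len c * down c \<sigma> \<tau>" for \<sigma> \<tau>
      using mult_left_mono[OF load_le, of "edge_len c" c \<sigma> \<tau>] by (simp add: algebra_simps)
  qed (auto simp: down_append K_def descent_append sum.distrib algebra_simps descent_def)
  then show ?case
    by (simp add: R_def K_def descent_Suc[abs_def] algebra_simps)
qed

end

section \<open>From downward movement to travelled distance\<close>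

text \<open>Only nonempty prefixes contribute, at most one of each length, with weights 1/2, 1/4 and
  so on. This limits the unreturned descent of each server at the end.\<close>

lemma sum_inside_le:
  assumes "finite F" "[] \<notin> F"
  shows "(\<Sum>v\<in>F. edge_len v * inside v u) \<le> 1"
proof -
  define l where "l = length (list_decode u)"
  define P where "P = (\<lambda>j. take (Suc j) (list_decode u)) ` {..<l}"
  have inj: "inj_on (\<lambda>j. take (Suc j) (list_decode u)) {..<l}"
  proof (rule inj_onI)
    fix i j
    assume "i \<in> {..<l}" "j \<in> {..<l}" "take (Suc i) (list_decode u) = take (Suc j) (list_decode u)"
    then have "length (take (Suc i) (list_decode u)) = length (take (Suc j) (list_decode u))"
      by simp
    then show "i = j"
      using \<open>i \<in> {..<l}\<close> \<open>j \<in> {..<l}\<close> by (simp add: l_def)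
  qed
  have "v \<in> P" if "v \<in> F" "inside v u \<noteq> 0" for v
  proof -
    have "prefix v (list_decode u)" "v \<noteq> []"
      using that assms by (auto simp: inside_def)
    then have "v = take (Suc (length v - 1)) (list_decode u)" "length v - 1 < l"
      by (auto simp: prefix_def l_def neq_Nil_conv)
    then show ?thesis
      unfolding P_def by blast
  qed
  then have "(\<Sum>v\<in>F. edge_len v * inside v u) = (\<Sum>v\<in>F \<inter> P. edge_len v * inside v u)"
    by (intro sum.mono_neutral_right) (use assms in auto)
  also have "\<dots> \<le> (\<Sum>v\<in>P. edge_len v * inside v u)"
    by (intro sum_mono2) (auto simp: P_def inside_def)
  also have "\<dots> \<le> (\<Sum>v\<in>P. edge_len v)"
    by (intro sum_mono) (auto simp: inside_def)
  also have "\<dots> = (\<Sum>j<l. edge_len (take (Suc j) (list_decode u)))"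
    by (simp only: P_def sum.reindex[OF inj] o_def)
  also have "\<dots> = (\<Sum>j<l. (1/2) ^ Suc j)"
    by (intro sum.cong refl) (simp add: l_def min_absorb2 Suc_leI del: power_Suc)
  also have "\<dots> = 1 - (1/2) ^ l"
    by (induction l) auto
  finally show ?thesis
    by (simp add: order_trans[of _ "1 - (1/2) ^ l"])
qed

text \<open>A tree edge changes \<open>inside v\<close> only for its lower end \<open>v\<close>, so
  the left side is at most the weight on each edge and \<open>shortest_path_ge\<close>
  applies.\<close>

lemma tree_dist_ge:
  assumes "finite F"
  shows "(\<Sum>v\<in>F. edge_len v * \<bar>inside v x - inside v y\<bar>) \<le> tree_dist x y"
proof -
  let ?g = "\<lambda>x y. \<Sum>v\<in>F. edge_len v * \<bar>inside v x - inside v y\<bar>"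
  obtain p where "walk tree_edges x y p"
    using ex_walk by blast
  then show ?thesis
    unfolding tree_dist_def
  proof (rule shortest_path_ge[where g = ?g])
    fix x y z
    show "?g x z \<le> ?g x y + ?g y z"
      unfolding sum.distrib[symmetric] distrib_left[symmetric]
      by (intro sum_mono mult_left_mono) auto
  next
    have le: "(\<Sum>v\<in>F. edge_len v * \<bar>inside v (list_encode xs) - inside v (list_encode (xs @ [i]))\<bar>)
        \<le> (1/2) ^ Suc (length xs)" for xs i
    proof -
      have "(\<Sum>v\<in>F. edge_len v * \<bar>inside v (list_encode xs) - inside v (list_encode (xs @ [i]))\<bar>)
          = (\<Sum>v\<in>F. if v = xs @ [i] then edge_len v else 0)"
        by (intro sum.cong) (auto simp: inside_def)
      also have "\<dots> \<le> (1/2) ^ Suc (length xs)"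
        using assms by (simp add: sum.delta)
      finally show ?thesis .
    qed
    fix x y
    assume "{x, y} \<in> tree_edges"
    then show "?g x y \<le> edge_weight {x, y}"
      unfolding tree_edges_iff
    proof (elim disjE exE conjE)
      fix xs i
      assume "x = list_encode xs" "y = list_encode (xs @ [i])"
      then show ?thesis
        using le[of xs i] by simp
    next
      fix xs i
      assume "y = list_encode xs" "x = list_encode (xs @ [i])"
      then show ?thesis
        using le[of xs i] edge_weight_edge[of xs i] by (simp add: abs_minus_commute insert_commute)
    qed
  qed simp
qed

text \<open>Every move down an edge is followed by a move up, except for those accounted for by the final
  positions, whose depths are worth less than 1 per server.\<close>

lemma schedule_cost_ge:
  assumes F: "finite F" "[] \<notin> F" and init: "\<And>i. i < k \<Longrightarrow> A [] i = list_encode []"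
  shows "schedule_cost tree_dist k \<sigma> (run A \<sigma>) \<ge>
    2 * (\<Sum>v\<in>F. edge_len v * down k A v [] \<sigma>) - real k"
proof -
  have *: "(\<Sum>t<length \<tau>. \<Sum>i<k. tree_dist (A (\<sigma> @ take t \<tau>) i) (A (\<sigma> @ take (Suc t) \<tau>) i)) \<ge>
     (\<Sum>v\<in>F. edge_len v * (2 * down k A v \<sigma> \<tau> - (load k A v (\<sigma> @ \<tau>) - load k A v \<sigma>)))" for \<sigma> \<tau>
  proof (induction \<tau> arbitrary: \<sigma>)
    case (Cons r \<tau>)
    let ?\<Delta> = "\<lambda>v i. inside v (A (\<sigma> @ [r]) i) - inside v (A \<sigma> i)"
    have "(\<Sum>v\<in>F. edge_len v * (2 * (\<Sum>i<k. max 0 (?\<Delta> v i)) - (load k A v (\<sigma> @ [r]) - load k A v \<sigma>)))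
        = (\<Sum>v\<in>F. \<Sum>i<k. edge_len v * \<bar>inside v (A \<sigma> i) - inside v (A (\<sigma> @ [r]) i)\<bar>)"
    proof (rule sum.cong)
      fix v
      have "2 * (\<Sum>i<k. max 0 (?\<Delta> v i)) - (load k A v (\<sigma> @ [r]) - load k A v \<sigma>)
          = (\<Sum>i<k. 2 * max 0 (?\<Delta> v i) - ?\<Delta> v i)"
        by (simp add: load_def sum_subtractf sum_distrib_left)
      \<comment> \<open>As \<open>2 * max 0 z - z\<close> is the absolute value of \<open>z\<close>,
        twice the descents minus the net gain counts the crossings in both directions.\<close>
      also have "\<dots> = (\<Sum>i<k. \<bar>inside v (A \<sigma> i) - inside v (A (\<sigma> @ [r]) i)\<bar>)"
        by (intro sum.cong) (auto simp: max_def)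
      finally show "edge_len v * (2 * (\<Sum>i<k. max 0 (?\<Delta> v i)) - (load k A v (\<sigma> @ [r]) - load k A v \<sigma>))
          = (\<Sum>i<k. edge_len v * \<bar>inside v (A \<sigma> i) - inside v (A (\<sigma> @ [r]) i)\<bar>)"
        by (simp add: sum_distrib_left)
    qed simp
    also have "\<dots> = (\<Sum>i<k. \<Sum>v\<in>F. edge_len v * \<bar>inside v (A \<sigma> i) - inside v (A (\<sigma> @ [r]) i)\<bar>)"
      by (rule sum.swap)
    also have "\<dots> \<le> (\<Sum>i<k. tree_dist (A \<sigma> i) (A (\<sigma> @ [r]) i))"
      by (intro sum_mono tree_dist_ge F)
    finally have step: "(\<Sum>v\<in>F. edge_len v * (2 * (\<Sum>i<k. max 0 (?\<Delta> v i)) -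
        (load k A v (\<sigma> @ [r]) - load k A v \<sigma>))) \<le> (\<Sum>i<k. tree_dist (A \<sigma> i) (A (\<sigma> @ [r]) i))" .
    have "(\<Sum>v\<in>F. edge_len v * (2 * down k A v \<sigma> (r # \<tau>) - (load k A v (\<sigma> @ r # \<tau>) - load k A v \<sigma>)))
        = (\<Sum>v\<in>F. edge_len v * (2 * (\<Sum>i<k. max 0 (?\<Delta> v i)) - (load k A v (\<sigma> @ [r]) - load k A v \<sigma>)))
        + (\<Sum>v\<in>F. edge_len v * (2 * down k A v (\<sigma> @ [r]) \<tau> -
            (load k A v ((\<sigma> @ [r]) @ \<tau>) - load k A v (\<sigma> @ [r]))))"
      unfolding sum.distrib[symmetric] distrib_left[symmetric] by (intro sum.cong) auto
    then show ?case
      using step Cons[of "\<sigma> @ [r]"] by (simp add: sum.lessThan_Suc_shift del: sum.lessThan_Suc)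
  qed simp
  have "(\<Sum>v\<in>F. edge_len v * load k A v \<sigma>) = (\<Sum>i<k. \<Sum>v\<in>F. edge_len v * inside v (A \<sigma> i))"
    unfolding load_def sum_distrib_left by (rule sum.swap)
  also have "\<dots> \<le> (\<Sum>i<k. 1)"
    by (intro sum_mono sum_inside_le F)
  finally have fin: "(\<Sum>v\<in>F. edge_len v * load k A v \<sigma>) \<le> real k"
    by simp
  have "load k A v [] = 0" if "v \<in> F" for v
    using F that by (auto simp: load_def inside_def init intro!: sum.neutral)
  then have "(\<Sum>v\<in>F. edge_len v * (2 * down k A v [] \<sigma> - (load k A v \<sigma> - load k A v []))) =
      2 * (\<Sum>v\<in>F. edge_len v * down k A v [] \<sigma>) - (\<Sum>v\<in>F. edge_len v * load k A v \<sigma>)"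
    unfolding sum_distrib_left sum_subtractf[symmetric] by (intro sum.cong) (auto simp: algebra_simps)
  then show ?thesis
    using *[where \<sigma>="[]" and \<tau>=\<sigma>] fin by (simp add: schedule_cost_def run_def)
qed

abbreviation phases :: "nat \<Rightarrow> nat \<Rightarrow> nat \<Rightarrow> nat \<Rightarrow> nat strategy" where
  "phases m s n P \<equiv> seqs P (\<lambda>p. game m s n [p])"

text \<open>The load below \<open>[p]\<close> is 0 at the very start, and servers that enter before
  phase \<open>p\<close> are charged by \<open>expect_seqs_ge\<close>. The length 1/2 of the edge
  above \<open>[p]\<close> cancels against the factor 2 for moving back up. The loss
  \<open>k\<close> occurs only once, not per phase.\<close>

lemma expect_cost_phases_ge:
  assumes "online_algorithm UNIV (list_encode []) k A"
  shows "expect (phases m s n P) (\<lambda>\<sigma>. schedule_cost tree_dist k \<sigma> (run A \<sigma>)) \<ge>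
    real P * real s ^ n - real k"
proof -
  have sched: "schedule UNIV (list_encode []) k \<sigma> (run A \<sigma>)" for \<sigma>
    using assms by (simp add: online_algorithm_def)
  have init: "A [] i = list_encode []" if "i < k" for i
    using sched[of "[]"] that by (auto simp: schedule_def run_def)
  have server: "\<exists>i<k. A (\<sigma> @ [r]) i = r" for \<sigma> r
  proof -
    have "\<forall>t<length (\<sigma> @ [r]). \<exists>i<k. run A (\<sigma> @ [r]) (Suc t) i = (\<sigma> @ [r]) ! t"
      using sched[of "\<sigma> @ [r]"] unfolding schedule_def by blast
    from this[rule_format, of "length \<sigma>"] show ?thesis
      by (simp add: run_def)
  qed
  have phase: "1/2 * real s ^ n \<le> expect (phases m s n P) (descent k A s n [p] [])" if "p < P" for p
  proof -
    have "1/2 * real s ^ n - 1/2 * load k A [p] [] \<le> expect (phases m s n P) (descent k A s n [p] [])"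
    proof (rule expect_seqs_ge[where x = "\<lambda>\<sigma>. 1/2 * load k A [p] \<sigma>"
          and K = "descent k A s n [p]", OF _ _ _ that])
      fix \<sigma> \<tau>
      show "1/2 * load k A [p] (\<sigma> @ \<tau>) \<le> 1/2 * load k A [p] \<sigma> + descent k A s n [p] \<sigma> \<tau>"
        using load_le[of k A "[p]" \<sigma> \<tau>] descent_ge_down[of "[p]" k A \<sigma> \<tau> s n] by simp
    next
      fix \<sigma>
      show "1/2 * real s ^ n - 1/2 * load k A [p] \<sigma> \<le>
          expect (game m s n [p]) (descent k A s n [p] \<sigma>)"
        using expect_descent_game[OF server, where m = m and s = s and n = n and c = "[p]" and \<sigma> = \<sigma>] by (simp add: algebra_simps)
    qed (auto simp: descent_append descent_nonneg)
    moreover have "load k A [p] [] = 0"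
      by (auto simp: load_def inside_def init intro!: sum.neutral)
    ultimately show ?thesis
      by simp
  qed
  define F where "F = (\<Union>p<P. nodes s n [p])"
  have F: "finite F" "[] \<notin> F"
    by (auto simp: F_def dest: prefix_nodes)
  have disj: "nodes s n [p] \<inter> nodes s n [q] = {}" if "p \<noteq> q" for p q
    using nodes_disjoint[OF that, of s n "[]" n] by simp
  have "(\<Sum>v\<in>F. edge_len v * down k A v [] \<sigma>) = (\<Sum>p<P. descent k A s n [p] [] \<sigma>)" for \<sigma>
    unfolding F_def descent_def by (rule sum.UNION_disjoint) (auto simp: disj)
  then have ge: "2 * (\<Sum>p<P. descent k A s n [p] [] \<sigma>) - real k \<le>
      schedule_cost tree_dist k \<sigma> (run A \<sigma>)" for \<sigma>
    using schedule_cost_ge[where k = k and A = A, OF F init, of \<sigma>] by simp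
  have "real P * real s ^ n - real k = 2 * (\<Sum>p<P. 1/2 * real s ^ n) - real k"
    by simp
  also have "\<dots> \<le> 2 * (\<Sum>p<P. expect (phases m s n P) (descent k A s n [p] [])) - real k"
    by (intro diff_right_mono mult_left_mono sum_mono phase) auto
  also have "\<dots> = expect (phases m s n P) (\<lambda>\<sigma>. 2 * (\<Sum>p<P. descent k A s n [p] [] \<sigma>) - real k)"
    by (simp add: expect_diff expect_cmult expect_sum)
  also have "\<dots> \<le> expect (phases m s n P) (\<lambda>\<sigma>. schedule_cost tree_dist k \<sigma> (run A \<sigma>))"
    by (intro expect_mono ge)
  finally show ?thesis .
qed


section \<open>The offline cost\<close>

definition move_cost :: "nat \<Rightarrow> (nat \<Rightarrow> nat) \<Rightarrow> (nat \<Rightarrow> nat) \<Rightarrow> real" where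
  "move_cost m C D = (\<Sum>i<m. tree_dist (C i) (D i))"

text \<open>Unlike a schedule, a service may move its servers once more after the last request, so that
  services can be concatenated.\<close>

inductive service :: "nat \<Rightarrow> (nat \<Rightarrow> nat) \<Rightarrow> nat list \<Rightarrow> (nat \<Rightarrow> nat) \<Rightarrow> real \<Rightarrow> bool" for m where
  Nil: "move_cost m C D \<le> b \<Longrightarrow> service m C [] D b"
| Cons: "r \<in> D ` {..<m} \<Longrightarrow> service m D \<tau> C' b \<Longrightarrow> move_cost m C D + b \<le> b' \<Longrightarrow>
    service m C (r # \<tau>) C' b'"

lemma move_cost_nonneg [simp]: "move_cost m C D \<ge> 0"
  by (simp add: move_cost_def sum_nonneg)

lemma move_cost_same [simp]: "move_cost m C C = 0"
  by (simp add: move_cost_def)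

lemma move_cost_triangle: "move_cost m C C'' \<le> move_cost m C C' + move_cost m C' C''"
  unfolding move_cost_def sum.distrib[symmetric] by (intro sum_mono tree_dist_triangle)

lemma service_nonneg: "service m C \<tau> C' b \<Longrightarrow> b \<ge> 0"
proof (induction rule: service.induct)
  case (Nil C D b)
  then show ?case
    using move_cost_nonneg[of m C D] by linarith
next
  case (Cons r D \<tau> C' b C b')
  then show ?case
    using move_cost_nonneg[of m C D] by linarith
qed

lemma service_move:
  assumes "service m D \<tau> C' b" "move_cost m C D + b \<le> b'"
  shows "service m C \<tau> C' b'"
  using assms
proof cases
  case Nil
  then show ?thesis
    using assms(2) move_cost_triangle[of m C C' D] by (auto intro!: service.Nil)
next
  case (Cons r D' \<tau>' b1)
  have "move_cost m C D' + b1 \<le> b'"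
    using Cons(4) assms(2) move_cost_triangle[of m C D' D] by linarith
  then show ?thesis
    unfolding Cons(1) using Cons(2,3) by (intro service.Cons)
qed

lemma service_append:
  assumes "service m C \<tau> C' b" "service m C' \<tau>' C'' b'"
  shows "service m C (\<tau> @ \<tau>') C'' (b + b')"
  using assms
proof (induction arbitrary: rule: service.induct)
  case (Nil C D b)
  then show ?case
    by (auto intro: service_move)
next
  case (Cons r D \<tau> C' b1 C b2)
  have "service m C (r # (\<tau> @ \<tau>')) C'' (b2 + b')"
    by (rule service.Cons[OF Cons.hyps(1) Cons.IH[OF Cons.prems]]) (use Cons.hyps(3) in simp)
  then show ?case
    by simp
qed

text \<open>The additional servers stay parked at \<open>u\<close>.\<close>

lemma service_extend:
  assumes "service m C \<tau> C' b" "m \<le> m'"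
  shows "service m' (\<lambda>i. if i < m then C i else u) \<tau> (\<lambda>i. if i < m then C' i else u) b"
proof -
  have move: "move_cost m' (\<lambda>i. if i < m then C i else u) (\<lambda>i. if i < m then D i else u) =
      move_cost m C D" for C D
    unfolding move_cost_def
    by (rule sum.mono_neutral_cong_right) (use assms(2) in auto)
  show ?thesis
    using assms(1)
  proof induction
    case (Cons r D \<tau> C' b C b')
    then obtain i where "i < m" "r = D i"
      by auto
    then have "r \<in> (\<lambda>i. if i < m then D i else u) ` {..<m'}"
      using assms(2) by (intro image_eqI[of _ _ i]) auto
    then show ?case
      by (rule service.Cons[OF _ Cons.IH]) (use Cons.hyps(3) in \<open>simp add: move\<close>)
  qed (auto intro: service.Nil simp: move)
qed

lemma service_stay:
  assumes "set \<tau> \<subseteq> C ` {..<m}"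
  shows "service m C \<tau> C 0"
  using assms
proof (induction \<tau>)
  case (Cons r \<tau>)
  then show ?case
    by (intro service.Cons[where D = C and b = 0]) auto
qed (auto intro: service.Nil)

text \<open>Dropping the closing move of a service can only reduce its cost.\<close>

lemma schedule_of_service:
  assumes "service m C \<tau> C' b"
  shows "\<exists>S. S 0 = C \<and> (\<forall>t<length \<tau>. \<exists>i<m. S (Suc t) i = \<tau> ! t) \<and> schedule_cost tree_dist m \<tau> S \<le> b"
  using assms
proof induction
  case (Nil C D b)
  then show ?case
    using order_trans[OF move_cost_nonneg Nil]
    by (intro exI[of _ "\<lambda>_. C"]) (simp add: schedule_cost_def)
next
  case (Cons r D \<tau> C' b C b')
  then obtain S where S: "S 0 = D" "\<And>t. t < length \<tau> \<Longrightarrow> \<exists>i<m. S (Suc t) i = \<tau> ! t"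
    "schedule_cost tree_dist m \<tau> S \<le> b"
    by blast
  define S' where "S' = case_nat C S"
  have "schedule_cost tree_dist m (r # \<tau>) S' = move_cost m C D + schedule_cost tree_dist m \<tau> S"
    by (simp add: schedule_cost_def sum.lessThan_Suc_shift move_cost_def S'_def S(1) del: sum.lessThan_Suc)
  moreover have "\<exists>i<m. S' (Suc t) i = (r # \<tau>) ! t" if "t < length (r # \<tau>)" for t
    using that Cons.hyps(1) S(1,2) by (cases t) (auto simp: S'_def)
  ultimately show ?case
    using S(3) Cons.hyps(3) by (intro exI[of _ S']) (auto simp: S'_def)
qed

section \<open>Closed tours and their costs\<close>

definition tour_cost :: "nat \<Rightarrow> nat \<Rightarrow> nat list \<Rightarrow> real" where
  "tour_cost m u \<tau> = Inf {b. service m (\<lambda>_. u) \<tau> (\<lambda>_. u) b}"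

lemma tour_cost_le: "service m (\<lambda>_. u) \<tau> (\<lambda>_. u) b \<Longrightarrow> tour_cost m u \<tau> \<le> b"
  unfolding tour_cost_def
  by (rule cInf_lower) (auto intro!: bdd_belowI[of _ 0] dest: service_nonneg)

lemma ex_service:
  assumes "m > 0"
  shows "\<exists>b. service m C \<tau> C' b"
proof (induction \<tau> arbitrary: C)
  case Nil
  then show ?case
    using service.Nil by blast
next
  case (Cons r \<tau>)
  have "r \<in> (\<lambda>_. r) ` {..<m}"
    using assms by auto
  moreover obtain b where "service m (\<lambda>_. r) \<tau> C' b"
    using Cons by blast
  ultimately have "service m C (r # \<tau>) C' (move_cost m C (\<lambda>_. r) + b)"
    by (rule service.Cons) simp
  then show ?case
    by blast
qed

lemma tour_cost_greatest:
  assumes "m > 0" "\<And>b. service m (\<lambda>_. u) \<tau> (\<lambda>_. u) b \<Longrightarrow> z \<le> b"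
  shows "z \<le> tour_cost m u \<tau>"
  unfolding tour_cost_def
  by (rule cInf_greatest) (use assms ex_service[of m "\<lambda>_. u" \<tau> "\<lambda>_. u"] in auto)

lemma tour_cost_Nil [simp]:
  assumes "m > 0"
  shows "tour_cost m u [] = 0"
proof (rule antisym)
  show "tour_cost m u [] \<le> 0"
    by (rule tour_cost_le) (auto intro: service.Nil)
  show "0 \<le> tour_cost m u []"
    using assms service_nonneg by (rule tour_cost_greatest)
qed

text \<open>Tours are closed, so two of them can be run one after the other.\<close>

lemma tour_cost_append:
  assumes "m > 0"
  shows "tour_cost m u (\<tau> @ \<tau>') \<le> tour_cost m u \<tau> + tour_cost m u \<tau>'"
proof -
  have "tour_cost m u (\<tau> @ \<tau>') - b \<le> tour_cost m u \<tau>'" if b: "service m (\<lambda>_. u) \<tau> (\<lambda>_. u) b" for b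
  proof (rule tour_cost_greatest[OF assms])
    fix b'
    assume "service m (\<lambda>_. u) \<tau>' (\<lambda>_. u) b'"
    from tour_cost_le[OF service_append[OF b this]]
    show "tour_cost m u (\<tau> @ \<tau>') - b \<le> b'"
      by simp
  qed
  then have "tour_cost m u (\<tau> @ \<tau>') - tour_cost m u \<tau>' \<le> tour_cost m u \<tau>"
    by (intro tour_cost_greatest[OF assms]) (simp add: algebra_simps)
  then show ?thesis
    by simp
qed

text \<open>Renting: \<open>m\<close> servers travel from \<open>u\<close> to \<open>v\<close> and
  back once, while the others stay at \<open>u\<close>.\<close>

lemma tour_cost_via:
  assumes "m > 0" "m \<le> m'"
  shows "tour_cost m' u \<tau> \<le> 2 * real m * tree_dist u v + tour_cost m v \<tau>"
proof -
  have "tour_cost m' u \<tau> - 2 * real m * tree_dist u v \<le> b" if b: "service m (\<lambda>_. v) \<tau> (\<lambda>_. v) b" for b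
  proof -
    have "service m (\<lambda>_. v) [] (\<lambda>_. u) (real m * tree_dist u v)"
      by (intro service.Nil) (simp add: move_cost_def tree_dist_commute)
    from service_append[OF b this]
    have "service m (\<lambda>_. v) \<tau> (\<lambda>_. u) (b + real m * tree_dist u v)"
      by simp
    then have "service m (\<lambda>_. u) \<tau> (\<lambda>_. u) (b + 2 * real m * tree_dist u v)"
      by (rule service_move) (simp add: move_cost_def)
    from tour_cost_le[OF service_extend[OF this assms(2), of u, simplified]] show ?thesis
      by simp
  qed
  then have "tour_cost m' u \<tau> - 2 * real m * tree_dist u v \<le> tour_cost m v \<tau>"
    by (rule tour_cost_greatest[OF assms(1)])
  then show ?thesis
    by simp
qed

text \<open>Covering: once every point of \<open>L\<close> holds a server, all of
  \<open>\<tau>\<close> is free, so the bound does not depend on the length of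
  \<open>\<tau>\<close>.\<close>

lemma tour_cost_cover:
  assumes "finite L" "L \<noteq> {}" "card L \<le> m" "set \<tau> \<subseteq> L" "\<And>v. v \<in> L \<Longrightarrow> tree_dist u v \<le> D"
  shows "tour_cost m u \<tau> \<le> 2 * real m * D"
proof -
  obtain f where f: "f ` {0..<card L} = L"
    using ex_bij_betw_nat_finite[OF assms(1)] unfolding bij_betw_def by blast
  \<comment> \<open>Surplus servers double up at \<open>f 0\<close>, which keeps all positions
    inside \<open>L\<close>.\<close>
  define C where "C i = (if i < card L then f i else f 0)" for i
  have "0 < card L"
    using assms(1,2) by (simp add: card_gt_0_iff)
  moreover have "f i \<in> L" if "i < card L" for i
    using imageI[of i "{0..<card L}" f] that by (simp add: f)
  ultimately have C: "C i \<in> L" for i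
    by (simp add: C_def)
  have "C ` {..<m} = L"
  proof
    show "L \<subseteq> C ` {..<m}"
    proof
      fix x
      assume "x \<in> L"
      then have "x \<in> f ` {0..<card L}"
        by (simp only: f)
      then obtain i where "i < card L" "x = f i"
        by auto
      then show "x \<in> C ` {..<m}"
        using assms(3) by (intro image_eqI[of _ _ i]) (auto simp: C_def)
    qed
  qed (use C in auto)
  then have stay: "service m C \<tau> C 0"
    using assms(4) by (intro service_stay) simp
  have le: "move_cost m (\<lambda>_. u) C \<le> real m * D"
    unfolding move_cost_def using sum_bounded_above[of "{..<m}" "\<lambda>i. tree_dist u (C i)" D] assms(5) C by simp
  then have "service m C [] (\<lambda>_. u) (real m * D)"
    by (intro service.Nil) (simp add: move_cost_def tree_dist_commute)
  from service_append[OF stay this] have "service m C \<tau> (\<lambda>_. u) (real m * D)"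
    by simp
  then have "service m (\<lambda>_. u) \<tau> (\<lambda>_. u) (2 * real m * D)"
    by (rule service_move) (use le in \<open>simp add: algebra_simps\<close>)
  then show ?thesis
    by (rule tour_cost_le)
qed

lemma OPT_le_tour_cost:
  assumes "m > 0" "m \<le> h"
  shows "OPT UNIV tree_dist r h \<sigma> \<le> tour_cost m r \<sigma>"
proof (rule tour_cost_greatest[OF assms(1)])
  fix b
  assume "service m (\<lambda>_. r) \<sigma> (\<lambda>_. r) b"
  from schedule_of_service[OF service_extend[OF this assms(2), of r, simplified]]
  obtain S where S: "S 0 = (\<lambda>_. r)" "\<forall>t<length \<sigma>. \<exists>i<h. S (Suc t) i = \<sigma> ! t"
    "schedule_cost tree_dist h \<sigma> S \<le> b"
    by blast
  have "OPT UNIV tree_dist r h \<sigma> \<le> schedule_cost tree_dist h \<sigma> S"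
    unfolding OPT_def
    by (rule cINF_lower)
      (use S in \<open>auto intro!: bdd_belowI2[of _ 0] sum_nonneg simp: schedule_def schedule_cost_def\<close>)
  then show "OPT UNIV tree_dist r h \<sigma> \<le> b"
    using S(3) by simp
qed

text \<open>Subadditivity lets each component be charged separately, whatever was requested
  before.\<close>

lemma expect_seqs_le:
  assumes sub: "\<And>\<tau> \<tau>'. f (\<tau> @ \<tau>') \<le> f \<tau> + (f \<tau>' :: real)" and "f [] \<le> 0"
    and G: "\<And>i. i < l \<Longrightarrow> expect (G i) f \<le> b"
  shows "expect (seqs l G) f \<le> real l * b"
  using G
proof (induction l)
  case (Suc l)
  have "expect (seqs (Suc l) G) f \<le> expect (seqs l G) (\<lambda>\<tau>. f \<tau> + expect (G l) f)"
  proof -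
    have "expect (G l) (\<lambda>\<tau>'. f (\<tau> @ \<tau>')) \<le> f \<tau> + expect (G l) f" for \<tau>
      using expect_mono[of "G l" "\<lambda>\<tau>'. f (\<tau> @ \<tau>')" "\<lambda>\<tau>'. f \<tau> + f \<tau>'"] sub by (simp add: expect_add)
    then show ?thesis
      by (auto intro: expect_mono)
  qed
  also have "\<dots> \<le> real l * b + b"
    using Suc by (simp add: expect_add add_mono)
  finally show ?case
    by (simp add: algebra_simps)
qed (use assms(2) in simp)

text \<open>The bound \<open>B\<close> is used only if all \<open>j\<close> coins come up in favour of continuing.\<close>

lemma expect_rounds_le:
  assumes sub: "\<And>\<tau> \<tau>'. f (\<tau> @ \<tau>') \<le> f \<tau> + (f \<tau>' :: real)" and R: "expect R f \<le> b"
  shows "expect (rounds j R) (\<lambda>\<tau>. min (a + f \<tau>) B) \<le>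
    (1 - (1/2)^j) * a + b * (2 - (real j + 2) * (1/2)^j) + (1/2)^j * B"
proof (induction j arbitrary: a)
  case 0
  have "expect (rounds 0 R) (\<lambda>\<tau>. min (a + f \<tau>) B) \<le> expect (rounds 0 R) (\<lambda>_. B)"
    by (intro expect_mono) simp
  then show ?case
    unfolding expect_const by simp
next
  case (Suc j)
  \<comment> \<open>With probability \<open>?q\<close> all \<open>j\<close> coins continue, there
    are \<open>j + 2\<close> rounds, and \<open>B\<close> replaces their cost. The coefficient of
    \<open>b\<close> is therefore the expected number 2 of rounds minus the share
    \<open>(j + 2) * ?q\<close> of that event.\<close>
  let ?q = "(1/2::real)^j" and ?c = "b * (2 - (real j + 2) * (1/2)^j) + (1/2)^j * B"
  have "expect (rounds j R) (\<lambda>\<tau>'. min (a + f (\<tau> @ \<tau>')) B) \<le> (1 - ?q) * (a + f \<tau>) + ?c" for \<tau>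
  proof -
    have "expect (rounds j R) (\<lambda>\<tau>'. min (a + f (\<tau> @ \<tau>')) B) \<le>
        expect (rounds j R) (\<lambda>\<tau>'. min (a + f \<tau> + f \<tau>') B)"
      by (intro expect_mono min.mono order_refl) (use sub in \<open>simp add: add.assoc\<close>)
    \<comment> \<open>Rent already paid moves into the offset: the induction hypothesis is used with
      \<open>a + f \<tau>\<close> for \<open>a\<close>.\<close>
    also note Suc
    finally show ?thesis
      by simp
  qed
  then have "expect (rounds (Suc j) R) (\<lambda>\<tau>. min (a + f \<tau>) B) \<le>
      expect R (\<lambda>\<tau>. ((a + f \<tau>) + ((1 - ?q) * (a + f \<tau>) + ?c)) / 2)"
    by (auto intro!: expect_mono divide_right_mono add_mono)
  also have "\<dots> = expect R (\<lambda>\<tau>. (1 - ?q/2) * f \<tau> + ((1 - ?q/2) * a + ?c / 2))"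
  proof -
    have "(a + x + ((1 - q) * (a + x) + c)) / 2 = (1 - q/2) * x + ((1 - q/2) * a + c / 2)"
      for q c x :: real
      by (simp add: field_simps)
    then show ?thesis
      by (simp only:)
  qed
  also have "\<dots> = (1 - ?q/2) * expect R f + ((1 - ?q/2) * a + ?c / 2)"
    by (simp only: expect_add expect_cmult expect_const)
  also have "\<dots> \<le> (1 - ?q/2) * b + ((1 - ?q/2) * a + ?c / 2)"
    using R power_le_one[of "1/2::real" j] by (intro add_right_mono mult_left_mono) auto
  also have "\<dots> = (1 - (1/2) ^ Suc j) * a + b * (2 - (real (Suc j) + 2) * (1/2) ^ Suc j) + (1/2) ^ Suc j * B"
  proof -
    have "(1 - q/2) * b + ((1 - q/2) * a + (b * (2 - (l + 2) * q) + q * B) / 2) =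
        (1 - 1/2 * q) * a + b * (2 - (1 + l + 2) * (1/2 * q)) + 1/2 * q * B" for q l :: real
      by (simp add: field_simps)
    then show ?thesis
      by (simp only: power_Suc of_nat_Suc)
  qed
  finally show ?case .
qed

section \<open>Offline cost of the recursive game\<close>

primrec leaves :: "nat \<Rightarrow> nat \<Rightarrow> nat list \<Rightarrow> nat list set" where
  "leaves s 0 c = {c}"
| "leaves s (Suc n) c = (\<Union>i<s. leaves s n (c @ [i]))"

lemma finite_leaves [simp]: "finite (leaves s n c)"
  by (induction n arbitrary: c) auto

lemma leaves_nonempty: "s > 0 \<Longrightarrow> leaves s n c \<noteq> {}"
  by (induction n arbitrary: c) auto

lemma card_leaves: "card (leaves s n c) \<le> s ^ n"
proof (induction n arbitrary: c)
  case (Suc n)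
  have "card (leaves s (Suc n) c) \<le> (\<Sum>i<s. card (leaves s n (c @ [i])))"
    unfolding leaves.simps by (rule card_UN_le) simp
  also have "\<dots> \<le> (\<Sum>i<s. s ^ n)"
    by (intro sum_mono Suc)
  finally show ?case
    by simp
qed simp

lemma prefix_leaves: "v \<in> leaves s n c \<Longrightarrow> prefix c v"
  by (induction n arbitrary: c) (auto dest: append_prefixD)

lemma set_strategy_seqs: "set_strategy (seqs l G) = (\<Union>i<l. set_strategy (G i))"
  by (induction l) (auto simp: lessThan_Suc)

lemma set_strategy_rounds: "set_strategy (rounds j R) = set_strategy R"
  by (induction j) auto

lemma set_strategy_game: "set_strategy (game m s n c) = list_encode ` leaves s n c"
  by (induction n arbitrary: c) (auto simp: set_strategy_seqs set_strategy_rounds)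

text \<open>An upper bound for the ratio of offline to online cost of \<open>game m s n\<close>.\<close>

primrec tour_ratio :: "nat \<Rightarrow> nat \<Rightarrow> nat \<Rightarrow> real" where
  "tour_ratio m s 0 = 1"
| "tour_ratio m s (Suc n) =
     1 / real s + tour_ratio m s n * (1 - (real m + 2) * (1/2) ^ Suc m) + 2 * (1/2) ^ m"

text \<open>Tours start at the parent \<open>p\<close>, so they also pay for the edge to
  \<open>p @ [i]\<close>. The factor in front of \<open>tour_ratio\<close> is twice the bound of
  \<open>expect_descent_game\<close> for load 0, that is, the online cost including the way back
  up.\<close>

lemma expect_tour_cost_game:
  assumes "s > 0"
  shows "expect (game m s n (p @ [i])) (tour_cost (s ^ n) (list_encode p)) \<le>
    edge_len p * real s ^ n * tour_ratio m s n"
proof (induction n arbitrary: p i)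
  case 0
  have "tree_dist (list_encode p) (list_encode (p @ [i])) \<le> edge_len p / 2"
    using tree_dist_child[of p i] by simp
  then have "tour_cost 1 (list_encode p) [list_encode (p @ [i])] \<le> 2 * real 1 * (edge_len p / 2)"
    by (intro tour_cost_cover[of "{list_encode (p @ [i])}"]) auto
  then show ?case
    by simp
next
  case (Suc n)
  define c where "c = p @ [i]"
  define R where "R = seqs s (\<lambda>i. game m s n (c @ [i]))"
  define N where "N = real s ^ n"
  define e where "e = edge_len p"
  define f where "f = tour_cost (s ^ n) (list_encode c)"
  have [simp]: "0 < s ^ n"
    using assms by simp
  have sub: "f (\<tau> @ \<tau>') \<le> f \<tau> + f \<tau>'" for \<tau> \<tau>'
    unfolding f_def by (rule tour_cost_append) (simp add: assms)
  have R: "expect R f \<le> real s * (e / 2 * N * tour_ratio m s n)"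
    unfolding R_def
  proof (rule expect_seqs_le[OF sub])
    show "expect (game m s n (c @ [i])) f \<le> e / 2 * N * tour_ratio m s n" for i
      using Suc[of c i] by (simp add: f_def c_def e_def N_def)
  qed (simp add: f_def assms)
  \<comment> \<open>The two offline options: send \<open>s ^ n\<close> servers to \<open>c\<close>
    and rent there, or cover all leaves with \<open>s ^ Suc n\<close> servers.\<close>
  have le: "tour_cost (s ^ Suc n) (list_encode p) \<tau> \<le> min (N * e + f \<tau>) (2 * real s * N * e)"
    if "set \<tau> \<subseteq> set_strategy (game m s (Suc n) c)" for \<tau>
  proof (rule min.boundedI)
    have "tour_cost (s ^ Suc n) (list_encode p) \<tau> \<le>
        2 * real (s ^ n) * tree_dist (list_encode p) (list_encode c) + f \<tau>"
      unfolding f_def by (rule tour_cost_via) (use assms in auto)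
    moreover have "2 * N * tree_dist (list_encode p) (list_encode c) \<le> 2 * N * (e / 2)"
      using tree_dist_child[of p i] by (intro mult_left_mono) (auto simp: e_def c_def N_def)
    ultimately show "tour_cost (s ^ Suc n) (list_encode p) \<tau> \<le> N * e + f \<tau>"
      by (simp add: N_def)
    have "tour_cost (s ^ Suc n) (list_encode p) \<tau> \<le> 2 * real (s ^ Suc n) * e"
    proof (rule tour_cost_cover[of "list_encode ` leaves s (Suc n) c"])
      show "card (list_encode ` leaves s (Suc n) c) \<le> s ^ Suc n"
        using card_image_le[OF finite_leaves, of list_encode s "Suc n" c] card_leaves[of s "Suc n" c] by linarith
      show "tree_dist (list_encode p) v \<le> e" if v: "v \<in> list_encode ` leaves s (Suc n) c" for v
      proof -
        obtain ys where "v = list_encode (p @ ys)"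
          using v by (auto simp del: leaves.simps dest!: prefix_leaves simp: c_def prefix_def)
        moreover have "0 \<le> edge_len (p @ ys)"
          by simp
        then have "tree_dist (list_encode p) (list_encode (p @ ys)) \<le> edge_len p"
          using tree_dist_descendant[of p ys] by linarith
        ultimately show ?thesis
          by (simp add: e_def)
      qed
    qed (use that leaves_nonempty[OF assms, of "Suc n" c] in
        \<open>auto simp del: leaves.simps game.simps simp: set_strategy_game\<close>)
    then show "tour_cost (s ^ Suc n) (list_encode p) \<tau> \<le> 2 * real s * N * e"
      by (simp add: N_def)
  qed
  have "expect (game m s (Suc n) c) (tour_cost (s ^ Suc n) (list_encode p)) \<le>
      expect (rounds m R) (\<lambda>\<tau>. min (N * e + f \<tau>) (2 * real s * N * e))"
    using expect_mono[OF le] by (simp add: R_def)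
  also have "\<dots> \<le> (1 - (1/2) ^ m) * (N * e) +
      real s * (e / 2 * N * tour_ratio m s n) * (2 - (real m + 2) * (1/2) ^ m) +
      (1/2) ^ m * (2 * real s * N * e)"
    by (rule expect_rounds_le[OF sub R])
  \<comment> \<open>The factor \<open>1 - (1/2) ^ m\<close> is dropped. Relative to
    \<open>e * (real s * N)\<close>, the term \<open>N * e\<close> is the summand
    \<open>1 / real s\<close> of \<open>tour_ratio\<close>.\<close>
  also have "\<dots> \<le> N * e +
      real s * (e / 2 * N * tour_ratio m s n) * (2 - (real m + 2) * (1/2) ^ m) +
      (1/2) ^ m * (2 * real s * N * e)"
    by (intro add_right_mono mult_left_le_one_le) (auto simp: N_def e_def power_le_one)
  also have "\<dots> = e * (real s * N) * tour_ratio m s (Suc n)"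
  proof -
    have "N * e + S * (e / 2 * N * x) * (2 - l * q) + q * (2 * S * N * e) =
        e * (S * N) * (1 / S + x * (1 - l * (1/2 * q)) + 2 * q)" if "S \<noteq> 0" for S x l q :: real
      using that by (simp add: field_simps)
    then show ?thesis
      using assms by (simp only: power_Suc tour_ratio.simps of_nat_eq_0_iff)
  qed
  finally show ?case
    by (simp add: c_def e_def N_def)
qed

lemma expect_OPT_phases_le:
  assumes "s > 0" "s ^ n \<le> h"
  shows "expect (phases m s n P) (OPT UNIV tree_dist (list_encode []) h) \<le>
    real P * (real s ^ n * tour_ratio m s n)"
proof -
  have pos: "s ^ n > 0"
    using assms by simp
  have "expect (phases m s n P) (OPT UNIV tree_dist (list_encode []) h) \<le>
      expect (phases m s n P) (tour_cost (s ^ n) (list_encode []))"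
    by (intro expect_mono OPT_le_tour_cost assms pos)
  also have "\<dots> \<le> real P * (real s ^ n * tour_ratio m s n)"
  proof (rule expect_seqs_le)
    show "expect (game m s n [p]) (tour_cost (s ^ n) (list_encode [])) \<le>
        real s ^ n * tour_ratio m s n" for p
      using expect_tour_cost_game[OF assms(1), of m n "[]" p] by simp
    show "tour_cost (s ^ n) (list_encode []) (\<tau> @ \<tau>') \<le>
        tour_cost (s ^ n) (list_encode []) \<tau> + tour_cost (s ^ n) (list_encode []) \<tau>'" for \<tau> \<tau>'
      by (rule tour_cost_append[OF pos])
    show "tour_cost (s ^ n) (list_encode []) [] \<le> 0"
      by (simp only: tour_cost_Nil[OF pos])
  qed
  finally show ?thesis .
qed


section \<open>The competitive ratio\<close>

text \<open>For \<open>s = 2 ^ m\<close> the recurrence is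
  \<open>t \<mapsto> 3 * (1/2) ^ m + (1 - x) * t\<close>, with fixed point
  \<open>6 / (m + 2)\<close>. The distance to it shrinks by the factor \<open>1 - x\<close> per
  level.\<close>

lemma tour_ratio_le: "tour_ratio m (2 ^ m) (2 ^ m) \<le> 8 / (real m + 2)"
proof -
  define x where "x = (real m + 2) * (1/2) ^ Suc m"
  have "real (m + 2) \<le> real (2 ^ Suc m)"
    using less_exp[of "Suc m"] by (intro of_nat_mono) simp
  then have x: "0 \<le> x" "x \<le> 1"
    by (simp_all add: x_def field_simps)
  have *: "tour_ratio m (2 ^ m) n \<le> 6 / (real m + 2) + (1 - x) ^ n" for n
  proof (induction n)
    case (Suc n)
    have "tour_ratio m (2 ^ m) (Suc n) = 3 * (1/2) ^ m + tour_ratio m (2 ^ m) n * (1 - x)"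
      by (simp add: x_def field_simps)
    also have "\<dots> \<le> 3 * (1/2) ^ m + (6 / (real m + 2) + (1 - x) ^ n) * (1 - x)"
      using x by (intro add_left_mono mult_right_mono Suc) auto
    also have "3 * (1/2) ^ m = 6 / (real m + 2) * x"
    proof -
      have "real m + 2 \<noteq> 0"
        by linarith
      then show ?thesis
        by (simp add: x_def)
    qed
    also have "\<dots> + (6 / (real m + 2) + (1 - x) ^ n) * (1 - x) = 6 / (real m + 2) + (1 - x) ^ Suc n"
    proof -
      have "w * x + (w + z) * (1 - x) = w + z * (1 - x)" for w z :: real
        by (simp add: algebra_simps)
      then show ?thesis
        by (simp only: power_Suc2)
    qed
    finally show ?case .
  qed simp
  \<comment> \<open>The number of levels is chosen such that \<open>2 ^ m * x\<close> equals
    \<open>(m + 2) / 2\<close>; the remaining distance is then at most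
    \<open>2 / (m + 2)\<close>.\<close>
  have "(1 - x) ^ 2 ^ m \<le> exp (- x) ^ 2 ^ m"
    using x exp_ge_add_one_self[of "- x"] by (intro power_mono) auto
  also have "\<dots> = exp (- ((real m + 2) / 2))"
    by (simp add: x_def field_simps flip: exp_of_nat_mult)
  also have "\<dots> \<le> 1 / (1 + (real m + 2) / 2)"
    unfolding exp_minus inverse_eq_divide by (intro frac_le exp_ge_add_one_self) (auto intro: add_pos_nonneg)
  also have "\<dots> \<le> 2 / (real m + 2)"
    by (simp add: field_simps)
  finally have "tour_ratio m (2 ^ m) (2 ^ m) \<le> 6 / (real m + 2) + 2 / (real m + 2)"
    using *[of "2 ^ m"] by linarith
  then show ?thesis
    by (simp add: add_divide_distrib[symmetric])
qed

lemma OPT_nonneg: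
  assumes "h > 0"
  shows "OPT UNIV tree_dist r h \<sigma> \<ge> 0"
proof -
  have "schedule UNIV r h \<sigma> (\<lambda>t i. if t = 0 then r else \<sigma> ! (t - 1))"
    using assms by (auto simp: schedule_def)
  then show ?thesis
    unfolding OPT_def
    by (intro cINF_greatest) (auto simp: schedule_cost_def intro!: sum_nonneg)
qed

text \<open>Online and offline costs are averaged over \<open>P\<close> phases. Both bounds are
  linear in \<open>P\<close>, so letting \<open>P\<close> grow makes \<open>k\<close> and
  \<open>C\<close> irrelevant.\<close>

lemma competitive_ge:
  assumes rand: "randomized_algorithm UNIV tree_dist (list_encode []) k M"
    and comp: "competitive UNIV tree_dist (list_encode []) h k \<rho> M"
    and h: "(2 ^ m) ^ (2 ^ m) \<le> h"
  shows "(real m + 2) / 8 \<le> \<rho>"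
proof -
  interpret prob_space M
    using rand by (simp add: randomized_algorithm_def)
  obtain C where int: "\<And>\<sigma>. integrable M (\<lambda>A. schedule_cost tree_dist k \<sigma> (run A \<sigma>))"
    and C: "\<And>\<sigma>. (\<integral>A. schedule_cost tree_dist k \<sigma> (run A \<sigma>) \<partial>M) \<le>
      \<rho> * OPT UNIV tree_dist (list_encode []) h \<sigma> + C"
    using comp by (auto simp: competitive_def)
  define s :: nat where "s = 2 ^ m"
  define n :: nat where "n = 2 ^ m"
  define N where "N = real s ^ n"
  \<comment> \<open>The sign of \<open>\<rho>\<close> is unknown; truncation at 0 makes
    multiplication monotone.\<close>
  define \<rho>' where "\<rho>' = max \<rho> 0"
  have "s > 0" "N > 0"
    by (simp_all add: s_def N_def)
  have h': "s ^ n \<le> h"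
    using h by (simp add: s_def n_def)
  have "h > 0"
    using h' \<open>s > 0\<close> by (meson less_le_trans zero_less_power)
  have P: "real P * (N * (1 - \<rho>' * (8 / (real m + 2)))) \<le> real k + C" for P
  proof -
    let ?E = "expect (phases m s n P)"
    let ?cost = "\<lambda>\<sigma> A. schedule_cost tree_dist k \<sigma> (run A \<sigma>)"
    let ?OPT = "OPT UNIV tree_dist (list_encode []) h"
    \<comment> \<open>The bound holds for every deterministic algorithm in \<open>space M\<close>,
      hence also for the mean.\<close>
    have "real P * N - real k \<le> (\<integral>A. ?E (\<lambda>\<sigma>. ?cost \<sigma> A) \<partial>M)"
      unfolding N_def
      using expect_integral(1)[OF int]
      by (rule integral_ge_const)
        (use rand expect_cost_phases_ge in \<open>auto simp: randomized_algorithm_def\<close>)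
    also have "\<dots> = ?E (\<lambda>\<sigma>. \<integral>A. ?cost \<sigma> A \<partial>M)"
      by (rule expect_integral(2)[OF int])
    also have "\<dots> \<le> ?E (\<lambda>\<sigma>. \<rho>' * ?OPT \<sigma> + C)"
    proof (rule expect_mono)
      fix \<sigma>
      have "\<rho> * ?OPT \<sigma> \<le> \<rho>' * ?OPT \<sigma>"
        using OPT_nonneg[OF \<open>h > 0\<close>] by (intro mult_right_mono) (auto simp: \<rho>'_def)
      then show "(\<integral>A. ?cost \<sigma> A \<partial>M) \<le> \<rho>' * ?OPT \<sigma> + C"
        using C[of \<sigma>] by linarith
    qed
    also have "\<dots> = \<rho>' * ?E ?OPT + C"
      by (simp add: expect_add expect_cmult)
    also have "\<dots> \<le> \<rho>' * (real P * (N * tour_ratio m s n)) + C"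
      unfolding N_def
      by (intro add_right_mono mult_left_mono expect_OPT_phases_le) (use h' \<open>s > 0\<close> in \<open>auto simp: \<rho>'_def\<close>)
    also have "\<dots> \<le> \<rho>' * (real P * (N * (8 / (real m + 2)))) + C"
      using tour_ratio_le[of m] \<open>N > 0\<close>
      by (intro add_right_mono mult_left_mono) (auto simp: \<rho>'_def s_def n_def)
    finally show ?thesis
      by (simp add: algebra_simps)
  qed
  have "N * (1 - \<rho>' * (8 / (real m + 2))) \<le> 0"
  proof (rule ccontr)
    assume "\<not> ?thesis"
    then obtain P where "real k + C < real P * (N * (1 - \<rho>' * (8 / (real m + 2))))"
      using reals_Archimedean3[of "N * (1 - \<rho>' * (8 / (real m + 2)))"] by auto
    then show False
      using P[of P] by linarith
  qed
  then have "1 \<le> \<rho>' * (8 / (real m + 2))"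
    using \<open>N > 0\<close> by (simp add: mult_le_0_iff)
  then have "(real m + 2) / 8 \<le> \<rho>'"
    by (simp add: field_simps)
  moreover have "0 < (real m + 2) / 8"
    by simp
  ultimately show ?thesis
    unfolding \<rho>'_def by linarith
qed

text \<open>Takes the first \<open>m\<close> for which \<open>m + 1\<close> asks for more than
  \<open>h\<close> servers. Since \<open>ln (T (Suc m))\<close> is at most
  \<open>2 ^ (2 * Suc m)\<close>, a second logarithm gives the bound.\<close>

lemma ex_depth:
  assumes "2 \<le> h"
  shows "\<exists>m. (2 ^ m) ^ (2 ^ m) \<le> h \<and> ln (ln (real h)) \<le> 2 * (real m + 1)"
proof -
  define T :: "nat \<Rightarrow> nat" where "T m = (2 ^ m) ^ (2 ^ m)" for m
  define m where "m = (LEAST m. h < T (Suc m))"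
  have "h < 2 ^ Suc h"
    using less_exp[of "Suc h"] by (rule Suc_lessD)
  also have "\<dots> \<le> T (Suc h)"
    unfolding T_def by (rule self_le_power) simp_all
  finally have upper: "h < T (Suc m)"
    unfolding m_def by (rule LeastI)
  have lower: "T m \<le> h"
  proof (cases m)
    case 0
    then show ?thesis
      using assms by (simp add: T_def)
  next
    case (Suc m')
    then have "\<not> h < T (Suc m')"
      using not_less_Least[of m' "\<lambda>m. h < T (Suc m)"] by (simp add: m_def)
    then show ?thesis
      unfolding Suc by simp
  qed
  have "real h < real ((2 ^ Suc m) ^ (2 ^ Suc m))"
    using upper by (simp only: of_nat_less_iff T_def)
  then have "real h < (2 ^ Suc m) ^ (2 ^ Suc m)"
    by (simp only: of_nat_power of_nat_numeral)
  moreover have "0 < real h"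
    using assms by simp
  moreover have "(0::real) < (2 ^ Suc m) ^ (2 ^ Suc m)"
    by (simp only: zero_less_power zero_less_numeral)
  ultimately have "ln (real h) < ln ((2 ^ Suc m) ^ (2 ^ Suc m))"
    by (simp only: ln_less_cancel_iff)
  also have "\<dots> = 2 ^ Suc m * (real (Suc m) * ln 2)"
    by (simp only: ln_realpow zero_less_power zero_less_numeral of_nat_power of_nat_numeral)
  also have "\<dots> \<le> 2 ^ Suc m * (2 ^ Suc m * 1)"
  proof (intro mult_left_mono mult_mono)
    show "real (Suc m) \<le> 2 ^ Suc m"
      using of_nat_mono[OF less_imp_le[OF less_exp[of "Suc m"]], where 'a = real]
      by (simp only: of_nat_power of_nat_numeral)
    show "ln 2 \<le> (1::real)"
      using ln_le_minus_one[of "2::real"] by simp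
  qed auto
  also have "\<dots> = 2 ^ (2 * Suc m)"
    by (simp only: mult_2 power_add mult_1_right)
  finally have "ln (real h) < 2 ^ (2 * Suc m)" .
  moreover have "0 < ln (real h)"
    using assms by simp
  ultimately have "ln (ln (real h)) < ln (2 ^ (2 * Suc m))"
    by (simp only: ln_less_cancel_iff zero_less_power zero_less_numeral)
  also have "\<dots> = real (2 * Suc m) * ln 2"
    by (simp only: ln_realpow zero_less_numeral)
  also have "\<dots> \<le> real (2 * Suc m) * 1"
    using ln_le_minus_one[of "2::real"] by (intro mult_left_mono) auto
  finally show ?thesis
    using lower unfolding T_def by (intro exI[of _ m] conjI) simp_all
qed

theorem theorem1:
  shows "\<exists>(X :: nat set) d r. tree_metric X d \<and> r \<in> X \<and>
    (\<exists>c>0. \<exists>h\<^sub>0. \<forall>h k. h\<^sub>0 \<le> h \<longrightarrow> h \<le> k \<longrightarrow>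
       competitive_ratio X d r h k \<ge> ereal (c * ln (ln (real h))))"
proof -
  \<comment> \<open>The constant comes from
    \<open>2 * (m + 1) / 16 \<le> (m + 2) / 8\<close>.\<close>
  have "ereal (1/16 * ln (ln (real h))) \<le> competitive_ratio UNIV tree_dist (list_encode []) h k"
    if h: "2 \<le> h" for h k
  proof -
    obtain m where m: "(2 ^ m) ^ (2 ^ m) \<le> h" "ln (ln (real h)) \<le> 2 * (real m + 1)"
      using ex_depth[OF h] by blast
    have "1/16 * ln (ln (real h)) \<le> \<rho>"
      if "randomized_algorithm UNIV tree_dist (list_encode []) k M"
        "competitive UNIV tree_dist (list_encode []) h k \<rho> M" for \<rho> M
      using competitive_ge[OF that m(1)] m(2) by (simp add: field_simps)
    then show ?thesis
      unfolding competitive_ratio_def by (intro Inf_greatest) auto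
  qed
  then show ?thesis
    using tree_metric_tree_dist
    by (intro exI[of _ UNIV] exI[of _ tree_dist] exI[of _ "list_encode []"] conjI
        exI[of _ "1/16 :: real"] exI[of _ "2 :: nat"]) auto
qed

end
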